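(* Let $G$ be a Polish group, let $X$ be a Polish space, and let $m$ be a continuous topological partial action of $G$ on $X$ such that $G*X$ is a $G_\delta$ subset of $G\times X$. Let $X_G$ be the enveloping space of $m$. Then $X_G$ (with the quotient topology) is a $T_0$ space and its quotient Borel structure is standard. That is, there is a Polish topology $\tau$ on $X_G$ extending (i.e. finer than or equal to) the quotient topology of $X_G$ such that the quotient Borel structure of $X_G$ is equal to $\mathrm{Borel}(X_G,\tau)$. Moreover, identifying $X$ with $\iota(X)\subseteq X_G$ and writing $\tau_X$ for the topology on $X$ induced by $\tau$ under this identification, $\mathrm{Borel}(X)=\mathrm{Borel}(X,\tau_X)$; and the enveloping action $\mu: G\times X_G\to X_G$ is Borel measurable when $X_G$ carries the Borel structure $\mathrm{Borel}(X_G,\tau)$.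
   Context: A partial action of a group $G$ (identity $1$) on a set $X$ is a partially defined map $m: G\times X\to X$, $(g,x)\mapsto g\cdot x$, such that, writing $\exists g\cdot x$ to mean that $(g,x)$ is in the domain of $m$, for all $g,h\in G$ and $x\in X$: (PA1) if $\exists g\cdot x$ then $\exists g^{-1}\cdot(g\cdot x)$ and $g^{-1}\cdot(g\cdot x)=x$; (PA2) if $\exists g\cdot(h\cdot x)$ then $\exists (gh)\cdot x$ and $g\cdot(h\cdot x)=(gh)\cdot x$; (PA3) $\exists 1\cdot x$ and $1\cdot x=x$. Notation: $G*X=\{(g,x)\in G\times X:\exists g\cdot x\}$ (with the subspace topology from $G\times X$); $X_{g^{-1}}=\{x\in X:\exists g\cdot x\}$; $m_g: X_{g^{-1}}\to X_g$, $x\mapsto g\cdot x$ (a bijection). For $G$ a topological group and $X$ a topological space, the partial action is topological if each $X_g$ is open in $X$ and each $m_g$ is a homeomorphism; it is continuous if $m: G*X\to X$ is continuous. Enveloping space: define an equivalence relation $R$ on $G\times X$ by $(g,x)R(h,y)$ iff $x\in X_{g^{-1}h}$ and $m_{h^{-1}g}(x)=y$. Write $[g,x]$ for the class of $(g,x)$ and $X_G=(G\times X)/R$, with the quotient topology. The quotient Borel structure on $X_G$ consists of all $B\subseteq X_G$ whose preimage under the quotient map $G\times X\to X_G$ is Borel in $G\times X$. The enveloping action is $\mu: G\times X_G\to X_G$, $\mu(g,[h,x])=[gh,x]$. The map $\iota: X\to X_G$, $\iota(x)=[1,x]$, is injective (it is a homeomorphism onto its image for the quotient topology on $X_G$). A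 Polish space is a separable completely metrizable space; a Polish group is a topological group whose topology is Polish. $\mathrm{Borel}(Y)$ or $\mathrm{Borel}(Y,\sigma)$ denotes the $\sigma$-algebra generated by the open sets (of the topology $\sigma$). *)

theory Defs
  imports "HOL-Analysis.Analysis" "HOL-Algebra.Group"
begin

text \<open>Spaces are abstract topologies on a carrier set, so that the same notions apply to a type
  and to a set of equivalence classes.\<close>

definition polish_topology :: "'a topology \<Rightarrow> bool" where
  "polish_topology T \<longleftrightarrow> separable_space T \<and> completely_metrizable_space T"

definition borel_of :: "'a topology \<Rightarrow> 'a measure" where
  "borel_of T = sigma (topspace T) {U. openin T U}"

lemma space_borel_of [simp]: "space (borel_of T) = topspace T"
  unfolding borel_of_def by (rule space_measure_of) (auto dest: openin_subset)

lemma sets_borel_of: "sets (borel_of T) = sigma_sets (topspace T) {U. openin T U}"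
  unfolding borel_of_def by (rule sets_measure_of) (auto dest: openin_subset)

definition quotient_topology :: "'a topology \<Rightarrow> ('a \<Rightarrow> 'b) \<Rightarrow> 'b topology" where
  "quotient_topology T q =
     topology (\<lambda>U. U \<subseteq> q ` topspace T \<and> openin T {x \<in> topspace T. q x \<in> U})"

lemma openin_quotient_topology:
  "openin (quotient_topology T q) U \<longleftrightarrow>
     U \<subseteq> q ` topspace T \<and> openin T {x \<in> topspace T. q x \<in> U}"
proof -
  have "istopology (\<lambda>U. U \<subseteq> q ` topspace T \<and> openin T {x \<in> topspace T. q x \<in> U})"
    unfolding istopology_def
  proof (intro conjI allI impI; (elim conjE)?)
    fix S S'
    assume "openin T {x \<in> topspace T. q x \<in> S}" "openin T {x \<in> topspace T. q x \<in> S'}"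
    then have "openin T ({x \<in> topspace T. q x \<in> S} \<inter> {x \<in> topspace T. q x \<in> S'})"
      by (rule openin_Int)
    then show "openin T {x \<in> topspace T. q x \<in> S \<inter> S'}"
      by (rule back_subst[where P = "openin T"]) auto
  next
    fix K assume K: "\<forall>S\<in>K. S \<subseteq> q ` topspace T \<and> openin T {x \<in> topspace T. q x \<in> S}"
    then have "openin T (\<Union>S\<in>K. {x \<in> topspace T. q x \<in> S})" by blast
    then show "openin T {x \<in> topspace T. q x \<in> \<Union>K}"
      by (rule back_subst[where P = "openin T"]) auto
  qed auto
  then show ?thesis by (simp add: quotient_topology_def)
qed

lemma topspace_quotient_topology [simp]: "topspace (quotient_topology T q) = q ` topspace T"
proof (rule antisym)
  show "topspace (quotient_topology T q) \<subseteq> q ` topspace T"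
    by (rule conjunct1[OF iffD1[OF openin_quotient_topology openin_topspace]])
  have "{x \<in> topspace T. q x \<in> q ` topspace T} = topspace T" by auto
  then show "q ` topspace T \<subseteq> topspace (quotient_topology T q)"
    by (intro openin_subset) (simp add: openin_quotient_topology)
qed

lemma quotient_map_quotient_topology: "quotient_map T (quotient_topology T q) q"
  by (simp add: quotient_map_def openin_quotient_topology)

definition quotient_borel_sets :: "'a topology \<Rightarrow> ('a \<Rightarrow> 'b) \<Rightarrow> 'b set set" where
  "quotient_borel_sets T q =
     {B. B \<subseteq> q ` topspace T \<and> {x \<in> topspace T. q x \<in> B} \<in> sets (borel_of T)}"

locale topological_group = group G for G (structure) +
  fixes TG :: "'g topology"
  assumes topspace_eq: "topspace TG = carrier G"
    and continuous_mult: "continuous_map (prod_topology TG TG) TG (\<lambda>(g, h). g \<otimes> h)"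
    and continuous_inv: "continuous_map TG TG (\<lambda>g. inv g)"

definition polish_group :: "('g, 'b) monoid_scheme \<Rightarrow> 'g topology \<Rightarrow> bool" where
  "polish_group G TG \<longleftrightarrow> topological_group G TG \<and> polish_topology TG"

text \<open>The partial map \<open>m\<close> is defined at \<open>(g, x)\<close> iff \<open>(g, x) \<in> dom m\<close>; thus \<open>dom m\<close> is \<open>G * X\<close>.\<close>

locale partial_action = group G for G (structure) +
  fixes X :: "'x set" and m :: "'g \<times> 'x \<rightharpoonup> 'x"
  assumes dom_subset: "dom m \<subseteq> carrier G \<times> X"
    and ran_subset: "ran m \<subseteq> X"
    and PA1: "m (g, x) = Some y \<Longrightarrow> m (inv g, y) = Some x"
    and PA2: "m (h, x) = Some y \<Longrightarrow> m (g, y) = Some z \<Longrightarrow> m (g \<otimes> h, x) = Some z"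
    and PA3: "x \<in> X \<Longrightarrow> m (\<one>, x) = Some x"

text \<open>This is \<open>X\<^sub>g\<close>, which consists of the points at which \<open>g\<inverse>\<close> is defined.\<close>

definition pa_dom :: "('g, 'b) monoid_scheme \<Rightarrow> ('g \<times> 'x \<rightharpoonup> 'x) \<Rightarrow> 'g \<Rightarrow> 'x set" where
  "pa_dom G m g = {x. (inv\<^bsub>G\<^esub> g, x) \<in> dom m}"

definition topological_partial_action ::
  "('g, 'b) monoid_scheme \<Rightarrow> 'x topology \<Rightarrow> ('g \<times> 'x \<rightharpoonup> 'x) \<Rightarrow> bool" where
  "topological_partial_action G TX m \<longleftrightarrow>
     partial_action G (topspace TX) m \<and>
     (\<forall>g\<in>carrier G.
        openin TX (pa_dom G m g) \<and>
        homeomorphic_map (subtopology TX (pa_dom G m (inv\<^bsub>G\<^esub> g))) (subtopology TX (pa_dom G m g))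
          (\<lambda>x. the (m (g, x))))"

definition continuous_partial_action ::
  "'g topology \<Rightarrow> 'x topology \<Rightarrow> ('g \<times> 'x \<rightharpoonup> 'x) \<Rightarrow> bool" where
  "continuous_partial_action TG TX m \<longleftrightarrow>
     continuous_map (subtopology (prod_topology TG TX) (dom m)) TX (\<lambda>p. the (m p))"

definition env_rel ::
  "('g, 'b) monoid_scheme \<Rightarrow> 'x set \<Rightarrow> ('g \<times> 'x \<rightharpoonup> 'x) \<Rightarrow> (('g \<times> 'x) \<times> ('g \<times> 'x)) set" where
  "env_rel G X m =
     {((g, x), (h, y)) | g x h y.
        g \<in> carrier G \<and> x \<in> X \<and> h \<in> carrier G \<and> y \<in> X \<and>
        x \<in> pa_dom G m (inv\<^bsub>G\<^esub> g \<otimes>\<^bsub>G\<^esub> h) \<and> m (inv\<^bsub>G\<^esub> h \<otimes>\<^bsub>G\<^esub> g, x) = Some y}"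

definition env_class ::
  "('g, 'b) monoid_scheme \<Rightarrow> 'x set \<Rightarrow> ('g \<times> 'x \<rightharpoonup> 'x) \<Rightarrow> 'g \<times> 'x \<Rightarrow> ('g \<times> 'x) set" where
  "env_class G X m p = env_rel G X m `` {p}"

definition env_space ::
  "('g, 'b) monoid_scheme \<Rightarrow> 'x set \<Rightarrow> ('g \<times> 'x \<rightharpoonup> 'x) \<Rightarrow> ('g \<times> 'x) set set" where
  "env_space G X m = (carrier G \<times> X) // env_rel G X m"

definition env_topology ::
  "('g, 'b) monoid_scheme \<Rightarrow> 'g topology \<Rightarrow> 'x topology \<Rightarrow> ('g \<times> 'x \<rightharpoonup> 'x) \<Rightarrow>
     ('g \<times> 'x) set topology" where
  "env_topology G TG TX m =
     quotient_topology (prod_topology TG TX) (env_class G (topspace TX) m)"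

definition env_borel_sets ::
  "('g, 'b) monoid_scheme \<Rightarrow> 'g topology \<Rightarrow> 'x topology \<Rightarrow> ('g \<times> 'x \<rightharpoonup> 'x) \<Rightarrow>
     ('g \<times> 'x) set set set" where
  "env_borel_sets G TG TX m =
     quotient_borel_sets (prod_topology TG TX) (env_class G (topspace TX) m)"

text \<open>The union ranges over equal sets (see \<open>env_act_class\<close> below), so that \<open>\<mu>(g, [h, x]) = [gh, x]\<close>.\<close>

definition env_act ::
  "('g, 'b) monoid_scheme \<Rightarrow> 'x set \<Rightarrow> ('g \<times> 'x \<rightharpoonup> 'x) \<Rightarrow>
     'g \<times> ('g \<times> 'x) set \<Rightarrow> ('g \<times> 'x) set" where
  "env_act G X m = (\<lambda>(g, c). \<Union>(h, x)\<in>c. env_class G X m (g \<otimes>\<^bsub>G\<^esub> h, x))"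

definition env_embed ::
  "('g, 'b) monoid_scheme \<Rightarrow> 'x set \<Rightarrow> ('g \<times> 'x \<rightharpoonup> 'x) \<Rightarrow> 'x \<Rightarrow> ('g \<times> 'x) set" where
  "env_embed G X m x = env_class G X m (\<one>\<^bsub>G\<^esub>, x)"

context partial_action
begin

lemma env_rel_iff:
  "((g, x), (h, y)) \<in> env_rel G X m \<longleftrightarrow>
     g \<in> carrier G \<and> x \<in> X \<and> h \<in> carrier G \<and> y \<in> X \<and> m (inv h \<otimes> g, x) = Some y"
  by (auto simp: env_rel_def pa_dom_def inv_mult_group)

lemma equiv_env_rel: "equiv (carrier G \<times> X) (env_rel G X m)"
proof (rule equivI)
  show "env_rel G X m \<subseteq> (carrier G \<times> X) \<times> (carrier G \<times> X)"
    by (auto simp: env_rel_def)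
  show "refl_on (carrier G \<times> X) (env_rel G X m)"
    by (auto simp: refl_on_def env_rel_iff PA3)
  show "sym (env_rel G X m)"
  proof (rule symI, clarify)
    fix g x h y assume a: "((g, x), (h, y)) \<in> env_rel G X m"
    then have "m (inv h \<otimes> g, x) = Some y" by (simp add: env_rel_iff)
    then have "m (inv (inv h \<otimes> g), y) = Some x" by (rule PA1)
    then show "((h, y), (g, x)) \<in> env_rel G X m"
      using a by (simp add: env_rel_iff inv_mult_group)
  qed
  show "trans (env_rel G X m)"
  proof (rule transI, clarify)
    fix g x h y k z
    assume a: "((g, x), (h, y)) \<in> env_rel G X m" "((h, y), (k, z)) \<in> env_rel G X m"
    then have c: "g \<in> carrier G" "h \<in> carrier G" "k \<in> carrier G" by (auto simp: env_rel_iff)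
    have "m ((inv k \<otimes> h) \<otimes> (inv h \<otimes> g), x) = Some z"
      by (rule PA2[where y = y]) (use a in \<open>simp_all add: env_rel_iff\<close>)
    moreover have "(inv k \<otimes> h) \<otimes> (inv h \<otimes> g) = inv k \<otimes> g"
      using c by (simp add: m_assoc flip: m_assoc[of h "inv h" g])
    ultimately show "((g, x), (k, z)) \<in> env_rel G X m"
      using a by (auto simp: env_rel_iff)
  qed
qed

lemma env_act_class:
  assumes "g \<in> carrier G" "h \<in> carrier G" "x \<in> X"
  shows "env_act G X m (g, env_class G X m (h, x)) = env_class G X m (g \<otimes> h, x)"
proof -
  have "(\<lambda>(h, x). env_class G X m (g \<otimes> h, x)) respects env_rel G X m"
  proof (rule congruentI, clarify)
    fix h x k y assume r: "((h, x), (k, y)) \<in> env_rel G X m"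
    then have c: "h \<in> carrier G" "k \<in> carrier G" by (auto simp: env_rel_iff)
    have "inv (g \<otimes> k) \<otimes> (g \<otimes> h) = inv k \<otimes> h"
      using c assms(1) by (simp add: inv_mult_group m_assoc flip: m_assoc[of "inv g" g h])
    then have "((g \<otimes> h, x), (g \<otimes> k, y)) \<in> env_rel G X m"
      using r assms(1) by (auto simp: env_rel_iff)
    then show "env_class G X m (g \<otimes> h, x) = env_class G X m (g \<otimes> k, y)"
      unfolding env_class_def by (rule equiv_class_eq[OF equiv_env_rel])
  qed
  from UN_equiv_class[OF equiv_env_rel this, of "(h, x)"] assms
  show ?thesis by (simp add: env_act_def env_class_def)
qed

end

lemma topspace_env_topology:
  assumes "topspace TG = carrier G"
  shows "topspace (env_topology G TG TX m) = env_space G (topspace TX) m"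
  using assms by (auto simp: env_topology_def env_space_def env_class_def quotient_def)

end

theory Submission
  imports Defs
begin

text \<open>
  The quotient map \<open>q\<close> from the Polish space \<open>P = G \<times> X\<close> onto \<open>X\<^sub>G\<close> saturates open sets to open
  sets, and its fibres are \<open>G\<^sub>\<delta>\<close>: a fibre is relatively closed in a translate of \<open>G * X\<close>. These two
  properties suffice for everything except the statements about \<open>X\<close> and \<open>\<mu>\<close>.

  Topologically indistinguishable fibres are dense \<open>G\<^sub>\<delta>\<close> subsets of their common closure, hence meet;
  so the quotient is \<open>T\<^sub>0\<close>. For a countable base \<open>B\<close> of \<open>P\<close>, the map sending \<open>y\<close> to the set of all \<open>n\<close>
  with \<open>y \<in> q ` B n\<close> therefore embeds the quotient into Cantor space, and completeness of \<open>P\<close> makes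
  its range \<open>G\<^sub>\<delta>\<close>; the topology pulled back from Cantor space is \<open>\<tau>\<close>. It is generated by the sets
  \<open>q ` B n\<close> and their complements, so it has the same Borel sets as the quotient topology. A set whose
  preimage \<open>A\<close> is Borel is itself Borel because it consists of the points over which \<open>A\<close> is comeager in
  the fibre, and, as for the Vaught transform, such sets of points are Borel by induction on \<open>A\<close>.

  Finally \<open>X \<rightarrow> X\<^sub>G\<close> is an embedding and \<open>\<mu>\<close> is continuous for the quotient topology.\<close>

subsection \<open>Second countable and Polish topologies\<close>

lemma separable_metrizable_imp_second_countable:
  assumes "separable_space T" "metrizable_space T"
  shows "second_countable T"
proof -
  obtain M d where "Metric_space M d" and T: "T = Metric_space.mtopology M d"
    using assms(2) unfolding metrizable_space_def by blast
  then interpret Metric_space M d by simp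
  obtain C where C: "countable C" "C \<subseteq> M" "mtopology closure_of C = M"
    using assms(1) unfolding separable_space_def T by auto
  define \<B> where "\<B> = (\<lambda>(c, n::nat). mball c (1 / Suc n)) ` (C \<times> UNIV)"
  have "countable \<B>"
    unfolding \<B>_def using C(1) by auto
  moreover have "openin mtopology V" if "V \<in> \<B>" for V
    using that unfolding \<B>_def by auto
  moreover have "\<exists>V\<in>\<B>. x \<in> V \<and> V \<subseteq> U" if U: "openin mtopology U" "x \<in> U" for U x
  proof -
    obtain r where r: "r > 0" "mball x r \<subseteq> U" and x: "x \<in> M"
      using U openin_mtopology by blast
    \<comment> \<open>Half of \<open>r\<close> is spent on the distance from \<open>x\<close> to the
      centre \<open>c\<close> and half on the radius of the ball about \<open>c\<close>.\<close>
    obtain n :: nat where n: "1 / Suc n < r / 2"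
      using r(1) nat_approx_posE[of "r / 2"] by auto
    have "x \<in> mtopology closure_of C"
      using C x by simp
    moreover have "0 < 1 / real (Suc n)" by simp
    ultimately obtain c where c: "c \<in> C" "c \<in> mball x (1 / Suc n)"
      unfolding metric_closure_of by blast
    have "mball c (1 / Suc n) \<subseteq> mball x r"
      using c n x C(2) commute[of x c] by (intro mball_subset) (auto simp del: of_nat_Suc)
    moreover have "x \<in> mball c (1 / Suc n)"
      using c by (auto simp: commute)
    ultimately show ?thesis
      using r c unfolding \<B>_def by (intro bexI[of _ "mball c (1 / Suc n)"]) auto
  qed
  ultimately show ?thesis
    unfolding second_countable_def T by blast
qed

lemma polish_imp_second_countable:
  "polish_topology T \<Longrightarrow> second_countable T"
  unfolding polish_topology_def
  using completely_metrizable_imp_metrizable_space separable_metrizable_imp_second_countable by blast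

lemma second_countable_nat_base:
  assumes "second_countable T"
  obtains B :: "nat \<Rightarrow> 'a set"
  where "\<And>n. openin T (B n)"
    and "\<And>U x. openin T U \<Longrightarrow> x \<in> U \<Longrightarrow> \<exists>n. x \<in> B n \<and> B n \<subseteq> U"
proof -
  obtain \<B> where \<B>: "countable \<B>" "\<forall>V\<in>\<B>. openin T V"
    "\<forall>U x. openin T U \<and> x \<in> U \<longrightarrow> (\<exists>V\<in>\<B>. x \<in> V \<and> V \<subseteq> U)"
    using assms unfolding second_countable_def by blast
  \<comment> \<open>Adding the empty set makes the family nonempty, so it can be enumerated by all
    natural numbers even when \<open>\<B>\<close> is empty.\<close>
  obtain B :: "nat \<Rightarrow> 'a set" where B: "range B = insert {} \<B>"
    using \<B>(1) by (intro that[OF range_from_nat_into]) simp_all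
  show ?thesis
  proof
    show "openin T (B n)" for n
    proof -
      have "B n \<in> insert {} \<B>" using B by blast
      then show ?thesis using \<B>(2) by auto
    qed
    show "\<exists>n. x \<in> B n \<and> B n \<subseteq> U" if U: "openin T U" "x \<in> U" for U x
    proof -
      obtain V where "V \<in> \<B>" "x \<in> V" "V \<subseteq> U" using \<B>(3) U by blast
      moreover from this have "V \<in> range B" using B by simp
      ultimately show ?thesis by blast
    qed
  qed
qed

lemma second_countable_prod_topology:
  fixes S :: "'a topology" and T :: "'b topology"
  assumes "second_countable S" "second_countable T"
  shows "second_countable (prod_topology S T)"
proof -
  obtain B :: "nat \<Rightarrow> 'a set" where B: "\<And>n. openin S (B n)"
    "\<And>U x. openin S U \<Longrightarrow> x \<in> U \<Longrightarrow> \<exists>n. x \<in> B n \<and> B n \<subseteq> U"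
    using second_countable_nat_base[OF assms(1)] by blast
  obtain C :: "nat \<Rightarrow> 'b set" where C: "\<And>n. openin T (C n)"
    "\<And>U x. openin T U \<Longrightarrow> x \<in> U \<Longrightarrow> \<exists>n. x \<in> C n \<and> C n \<subseteq> U"
    using second_countable_nat_base[OF assms(2)] by blast
  let ?\<B> = "(\<lambda>(i, j). B i \<times> C j) ` UNIV"
  have "\<exists>V\<in>?\<B>. p \<in> V \<and> V \<subseteq> W" if W: "openin (prod_topology S T) W" "p \<in> W" for W p
  proof -
    obtain x y where p: "p = (x, y)" by force
    obtain U V where UV: "openin S U" "openin T V" "x \<in> U" "y \<in> V" "U \<times> V \<subseteq> W"
      using W(1)[unfolded openin_prod_topology_alt, rule_format] W(2) unfolding p by metis
    obtain i where "x \<in> B i" "B i \<subseteq> U" using B(2) UV by blast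
    moreover obtain j where "y \<in> C j" "C j \<subseteq> V" using C(2) UV by blast
    ultimately have "p \<in> B i \<times> C j" "B i \<times> C j \<subseteq> W" using UV p by auto
    then show ?thesis by auto
  qed
  moreover have "countable ?\<B>" by simp
  moreover have "\<forall>V\<in>?\<B>. openin (prod_topology S T) V"
    using B(1) C(1) by (auto simp: openin_prod_Times_iff)
  ultimately show ?thesis
    unfolding second_countable_def by blast
qed

lemma polish_prod_topology:
  assumes "polish_topology S" "polish_topology T"
  shows "polish_topology (prod_topology S T)"
  unfolding polish_topology_def
proof
  show "separable_space (prod_topology S T)"
    by (intro second_countable_imp_separable_space second_countable_prod_topology
        polish_imp_second_countable assms)
  show "completely_metrizable_space (prod_topology S T)"
    using assms by (simp add: polish_topology_def completely_metrizable_space_prod_topology)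
qed

section \<open>Open sets and continuous maps in the Borel structure\<close>

lemma openin_imp_borel_of: "openin T U \<Longrightarrow> U \<in> sets (borel_of T)"
  unfolding sets_borel_of by auto

lemma continuous_map_measurable_borel_of:
  assumes "continuous_map S T f"
  shows "f \<in> measurable (borel_of S) (borel_of T)"
  unfolding borel_of_def[of T]
proof (rule measurable_measure_of)
  show "{U. openin T U} \<subseteq> Pow (topspace T)"
    by (auto dest: openin_subset)
  show "f \<in> space (borel_of S) \<rightarrow> topspace T"
    using assms by (simp add: continuous_map_def)
  show "f -` U \<inter> space (borel_of S) \<in> sets (borel_of S)" if "U \<in> {U. openin T U}" for U
  proof -
    have "openin S {x \<in> topspace S. f x \<in> U}"
      using assms that by (auto simp: continuous_map_def)
    moreover have "f -` U \<inter> space (borel_of S) = {x \<in> topspace S. f x \<in> U}"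
      by auto
    ultimately show ?thesis
      by (simp add: openin_imp_borel_of)
  qed
qed

subsection \<open>Relative comeagerness\<close>

text \<open>\<open>A\<close> is comeager in \<open>V \<inter> F\<close>, for the subspace topology on \<open>F\<close>, when \<open>V\<close> is open; density is
  phrased through open sets of the ambient space.\<close>

definition rel_comeager :: "'a topology \<Rightarrow> 'a set \<Rightarrow> 'a set \<Rightarrow> 'a set \<Rightarrow> bool" where
  "rel_comeager T F V A \<longleftrightarrow>
     (\<exists>D :: nat \<Rightarrow> 'a set. (\<forall>n. openin T (D n)) \<and>
        (\<forall>n W. openin T W \<and> W \<subseteq> V \<and> W \<inter> F \<noteq> {} \<longrightarrow> W \<inter> D n \<inter> F \<noteq> {}) \<and>
        V \<inter> F \<inter> (\<Inter>n. D n) \<subseteq> A)"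

lemma rel_comeagerI:
  fixes D :: "nat \<Rightarrow> 'a set"
  assumes "\<And>n. openin T (D n)"
    and "\<And>n W. openin T W \<Longrightarrow> W \<subseteq> V \<Longrightarrow> W \<inter> F \<noteq> {} \<Longrightarrow> W \<inter> D n \<inter> F \<noteq> {}"
    and "\<And>x. x \<in> V \<Longrightarrow> x \<in> F \<Longrightarrow> (\<And>n. x \<in> D n) \<Longrightarrow> x \<in> A"
  shows "rel_comeager T F V A"
  unfolding rel_comeager_def by (rule exI[of _ D]) (use assms in auto)

lemma rel_comeagerE:
  assumes "rel_comeager T F V A"
  obtains D :: "nat \<Rightarrow> 'a set"
  where "\<And>n. openin T (D n)"
    and "\<And>n W. openin T W \<Longrightarrow> W \<subseteq> V \<Longrightarrow> W \<inter> F \<noteq> {} \<Longrightarrow> W \<inter> D n \<inter> F \<noteq> {}"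
    and "\<And>x. x \<in> V \<Longrightarrow> x \<in> F \<Longrightarrow> (\<And>n. x \<in> D n) \<Longrightarrow> x \<in> A"
proof -
  obtain D :: "nat \<Rightarrow> 'a set" where D: "\<forall>n. openin T (D n)"
    "\<forall>n W. openin T W \<and> W \<subseteq> V \<and> W \<inter> F \<noteq> {} \<longrightarrow> W \<inter> D n \<inter> F \<noteq> {}"
    "V \<inter> F \<inter> (\<Inter>n. D n) \<subseteq> A"
    using assms unfolding rel_comeager_def by (elim exE conjE) (rule that)
  show ?thesis
    by (rule that[of D]) (use D in auto)
qed

lemma rel_comeager_mono:
  assumes "rel_comeager T F V A" "V \<inter> F \<inter> A \<subseteq> A'"
  shows "rel_comeager T F V A'"
  using assms(1)
proof (rule rel_comeagerE)
  fix D :: "nat \<Rightarrow> 'a set"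
  assume D: "\<And>n. openin T (D n)"
    "\<And>n W. openin T W \<Longrightarrow> W \<subseteq> V \<Longrightarrow> W \<inter> F \<noteq> {} \<Longrightarrow> W \<inter> D n \<inter> F \<noteq> {}"
    "\<And>x. x \<in> V \<Longrightarrow> x \<in> F \<Longrightarrow> (\<And>n. x \<in> D n) \<Longrightarrow> x \<in> A"
  then show ?thesis
    using assms(2) by (intro rel_comeagerI[of T D]) auto
qed

lemma rel_comeager_antimono:
  assumes "rel_comeager T F V A" "V' \<subseteq> V"
  shows "rel_comeager T F V' A"
  using assms(1)
proof (rule rel_comeagerE)
  fix D :: "nat \<Rightarrow> 'a set"
  assume D: "\<And>n. openin T (D n)"
    "\<And>n W. openin T W \<Longrightarrow> W \<subseteq> V \<Longrightarrow> W \<inter> F \<noteq> {} \<Longrightarrow> W \<inter> D n \<inter> F \<noteq> {}"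
    "\<And>x. x \<in> V \<Longrightarrow> x \<in> F \<Longrightarrow> (\<And>n. x \<in> D n) \<Longrightarrow> x \<in> A"
  show ?thesis
    by (rule rel_comeagerI[of T D]) (use D assms(2) in \<open>blast+\<close>)
qed

lemma rel_comeager_superset:
  assumes "openin T V" "V \<inter> F \<subseteq> A"
  shows "rel_comeager T F V A"
  by (rule rel_comeagerI[of T "\<lambda>_. V"]) (use assms in blast)+

lemma rel_comeager_open:
  assumes "openin T A" "\<And>W. openin T W \<Longrightarrow> W \<subseteq> V \<Longrightarrow> W \<inter> F \<noteq> {} \<Longrightarrow> W \<inter> A \<inter> F \<noteq> {}"
  shows "rel_comeager T F V A"
  by (rule rel_comeagerI[of T "\<lambda>_. A"]) (use assms in blast)+

text \<open>Countably many sequences of dense open sets are merged into one by the pairing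
  function.\<close>

lemma rel_comeager_INT:
  fixes A :: "nat \<Rightarrow> 'a set"
  assumes "\<And>i. rel_comeager T F V (A i)"
  shows "rel_comeager T F V (\<Inter>i. A i)"
proof -
  have "\<forall>i. \<exists>D :: nat \<Rightarrow> 'a set. (\<forall>n. openin T (D n)) \<and>
        (\<forall>n W. openin T W \<and> W \<subseteq> V \<and> W \<inter> F \<noteq> {} \<longrightarrow> W \<inter> D n \<inter> F \<noteq> {}) \<and>
        V \<inter> F \<inter> (\<Inter>n. D n) \<subseteq> A i"
    using assms unfolding rel_comeager_def by blast
  then obtain D :: "nat \<Rightarrow> nat \<Rightarrow> 'a set" where D: "\<forall>i. (\<forall>n. openin T (D i n)) \<and>
        (\<forall>n W. openin T W \<and> W \<subseteq> V \<and> W \<inter> F \<noteq> {} \<longrightarrow> W \<inter> D i n \<inter> F \<noteq> {}) \<and>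
        V \<inter> F \<inter> (\<Inter>n. D i n) \<subseteq> A i"
    by (elim choice[THEN exE]) (rule that)
  define E where "E k = (case prod_decode k of (i, n) \<Rightarrow> D i n)" for k
  have E: "E (prod_encode (i, n)) = D i n" for i n
    by (simp add: E_def)
  show ?thesis
  proof (rule rel_comeagerI[of T E])
    show "openin T (E k)" for k
      using D by (simp add: E_def split: prod.split)
    show "W \<inter> E k \<inter> F \<noteq> {}" if "openin T W" "W \<subseteq> V" "W \<inter> F \<noteq> {}" for k W
      using D that by (simp add: E_def split: prod.split)
    show "x \<in> (\<Inter>i. A i)" if x: "x \<in> V" "x \<in> F" "\<And>k. x \<in> E k" for x
    proof
      fix i
      have "x \<in> D i n" for n
        using x(3)[of "prod_encode (i, n)"] by (simp only: E)
      then show "x \<in> A i" using D x by blast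
    qed
  qed
qed

lemma rel_comeager_Int:
  assumes "rel_comeager T F V A" "rel_comeager T F V A'"
  shows "rel_comeager T F V (A \<inter> A')"
proof -
  have "rel_comeager T F V (\<Inter>n::nat. if n = 0 then A else A')"
    by (rule rel_comeager_INT) (use assms in auto)
  moreover have "(\<Inter>n::nat. if n = 0 then A else A') \<subseteq> A \<inter> A'"
  proof
    fix x assume x: "x \<in> (\<Inter>n::nat. if n = 0 then A else A')"
    show "x \<in> A \<inter> A'"
      using INT_D[OF x, of 0] INT_D[OF x, of 1] by simp
  qed
  ultimately show ?thesis
    by (rule rel_comeager_mono[OF _ subset_trans[OF Int_lower2]])
qed

text \<open>Comeagerness is a local property. For each \<open>i\<close>, an open set meeting
  \<open>F\<close> either meets \<open>W i \<inter> F\<close>, where the given sets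
  \<open>D n\<close> are dense, or is disjoint from the closure of \<open>W i \<inter> F\<close>.
  Hence \<open>A\<close> becomes comeager in \<open>V\<close> once the exterior \<open>ext i\<close>
  of \<open>W i \<inter> F\<close> is added. A point of \<open>W i \<inter> F\<close> avoids
  \<open>ext i\<close>, and the union of the \<open>W i\<close> is open and dense in
  \<open>V \<inter> F\<close>, so intersecting over all \<open>i\<close> leaves only points of
  \<open>A\<close>.\<close>

lemma rel_comeager_local:
  fixes W :: "nat \<Rightarrow> 'a set"
  assumes W: "\<And>i. openin T (W i)" "\<And>i. rel_comeager T F (W i) A"
    and F: "F \<subseteq> topspace T"
    and dense: "\<And>U. openin T U \<Longrightarrow> U \<subseteq> V \<Longrightarrow> U \<inter> F \<noteq> {} \<Longrightarrow> \<exists>i. U \<inter> W i \<inter> F \<noteq> {}"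
  shows "rel_comeager T F V A"
proof -
  define ext where "ext i = topspace T - T closure_of (W i \<inter> F)" for i
  have "rel_comeager T F V (A \<union> ext i)" for i
  proof -
    from W(2) show ?thesis
    proof (rule rel_comeagerE)
      fix D :: "nat \<Rightarrow> 'a set"
      assume D: "\<And>n. openin T (D n)"
        "\<And>n U. openin T U \<Longrightarrow> U \<subseteq> W i \<Longrightarrow> U \<inter> F \<noteq> {} \<Longrightarrow> U \<inter> D n \<inter> F \<noteq> {}"
        "\<And>x. x \<in> W i \<Longrightarrow> x \<in> F \<Longrightarrow> (\<And>n. x \<in> D n) \<Longrightarrow> x \<in> A"
      show ?thesis
      proof (rule rel_comeagerI[of T "\<lambda>n. (D n \<inter> W i) \<union> ext i"])
        show "openin T ((D n \<inter> W i) \<union> ext i)" for n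
          using D(1) W(1) by (auto simp: ext_def intro!: openin_Un openin_Int openin_diff)
        show "U \<inter> (D n \<inter> W i \<union> ext i) \<inter> F \<noteq> {}" if U: "openin T U" "U \<subseteq> V" "U \<inter> F \<noteq> {}" for n U
        proof (cases "U \<inter> W i \<inter> F = {}")
          case True
          then have "U \<inter> T closure_of (W i \<inter> F) = {}"
            using U openin_Int_closure_of_eq_empty[of T U "W i \<inter> F"] by (simp add: Int_assoc)
          then show ?thesis
            using U F by (auto simp: ext_def)
        next
          case False
          then have "(U \<inter> W i) \<inter> D n \<inter> F \<noteq> {}"
            using D(2)[of "U \<inter> W i" n] U W(1) by blast
          then show ?thesis by blast
        qed
        show "x \<in> A \<union> ext i" if x: "x \<in> V" "x \<in> F" "\<And>n. x \<in> D n \<inter> W i \<union> ext i" for x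
          using x(2) x(3) D(3)[of x] by (cases "x \<in> ext i") auto
      qed
    qed
  qed
  then have 1: "rel_comeager T F V (\<Inter>i. A \<union> ext i)"
    by (rule rel_comeager_INT)
  have 2: "rel_comeager T F V (\<Union>i. W i)"
  proof (rule rel_comeager_open)
    show "openin T (\<Union>i. W i)" using W(1) by blast
    show "U \<inter> (\<Union>i. W i) \<inter> F \<noteq> {}" if "openin T U" "U \<subseteq> V" "U \<inter> F \<noteq> {}" for U
      using dense[OF that] by blast
  qed
  from rel_comeager_Int[OF 1 2] show ?thesis
  proof (rule rel_comeager_mono, intro subsetI)
    fix x assume "x \<in> V \<inter> F \<inter> ((\<Inter>i. A \<union> ext i) \<inter> (\<Union>i. W i))"
    then obtain i where "x \<in> W i" "x \<in> F" "x \<in> A \<union> ext i" by blast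
    moreover have "W i \<inter> F \<subseteq> T closure_of (W i \<inter> F)"
      using F by (intro closure_of_subset) auto
    ultimately show "x \<in> A" by (auto simp: ext_def)
  qed
qed

text \<open>This is the Baire category theorem in \<open>V \<inter> F\<close>, which is completely
  metrizable as an open subspace of \<open>F\<close>.\<close>

lemma rel_comeager_nonempty:
  assumes cm: "completely_metrizable_space (subtopology T F)" and "F \<subseteq> topspace T"
    and V: "openin T V" "V \<inter> F \<noteq> {}"
    and A: "rel_comeager T F V A"
  shows "V \<inter> F \<inter> A \<noteq> {}"
proof -
  obtain D :: "nat \<Rightarrow> 'a set" where D: "\<forall>n. openin T (D n)"
    "\<forall>n W. openin T W \<and> W \<subseteq> V \<and> W \<inter> F \<noteq> {} \<longrightarrow> W \<inter> D n \<inter> F \<noteq> {}"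
    "V \<inter> F \<inter> (\<Inter>n. D n) \<subseteq> A"
    using A unfolding rel_comeager_def by (elim exE conjE) (rule that)
  let ?S = "subtopology T (V \<inter> F)"
  have S: "topspace ?S = V \<inter> F"
    using assms(2) by auto
  have "openin (subtopology T F) (F \<inter> V)"
    using V(1) by (simp add: openin_subtopology_Int2)
  then have "completely_metrizable_space (subtopology (subtopology T F) (F \<inter> V))"
    using cm completely_metrizable_space_openin by blast
  then have cS: "completely_metrizable_space ?S"
    by (simp add: subtopology_subtopology Int_commute)
  have "?S closure_of (\<Inter>(range (\<lambda>n. V \<inter> F \<inter> D n))) = topspace ?S"
  proof (rule Baire_category)
    fix E assume "E \<in> range (\<lambda>n. V \<inter> F \<inter> D n)"
    then obtain n where E: "E = V \<inter> F \<inter> D n" by blast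
    have "openin ?S E"
      unfolding E using D(1) by (simp add: openin_subtopology_Int2)
    moreover have "?S closure_of E = topspace ?S"
    proof -
      have "U \<inter> E \<noteq> {}" if U: "openin ?S U" "U \<noteq> {}" for U
      proof -
        obtain W where W: "openin T W" "U = W \<inter> (V \<inter> F)"
          using U(1) unfolding openin_subtopology by blast
        have "(W \<inter> V) \<inter> D n \<inter> F \<noteq> {}"
          using W U V by (intro D(2)[rule_format]) auto
        then show ?thesis using W E by blast
      qed
      then show ?thesis
        unfolding dense_intersects_open by (simp add: Int_commute)
    qed
    ultimately show "openin ?S E \<and> ?S closure_of E = topspace ?S" by simp
  qed (use cS in auto)
  moreover have "topspace ?S \<noteq> {}"
    using S V by simp
  ultimately have "\<Inter>(range (\<lambda>n. V \<inter> F \<inter> D n)) \<noteq> {}"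
    by (metis closure_of_empty)
  then show ?thesis using D(3) by blast
qed

subsection \<open>Open quotients of Polish spaces\<close>

locale open_polish_quotient =
  fixes P :: "'a topology" and q :: "'a \<Rightarrow> 'b"
  assumes polish: "polish_topology P"
    and openin_saturation: "openin P U \<Longrightarrow> openin P {x \<in> topspace P. q x \<in> q ` U}"
    and gdelta_fibre: "y \<in> q ` topspace P \<Longrightarrow> gdelta_in P {x \<in> topspace P. q x = y}"
begin

abbreviation Y :: "'b topology" where
  "Y \<equiv> quotient_topology P q"

definition fibre :: "'b \<Rightarrow> 'a set" where
  "fibre y = {x \<in> topspace P. q x = y}"

lemma openin_image: "openin P U \<Longrightarrow> openin Y (q ` U)"
  using openin_saturation[of U] openin_subset[of P U] by (auto simp: openin_quotient_topology)

lemma fibre_subset: "fibre y \<subseteq> topspace P"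
  by (auto simp: fibre_def)

lemma fibre_meets_iff: "openin P U \<Longrightarrow> U \<inter> fibre y \<noteq> {} \<longleftrightarrow> y \<in> q ` U"
  using openin_subset[of P U] by (auto simp: fibre_def)

lemma completely_metrizable: "completely_metrizable_space P"
  using polish by (simp add: polish_topology_def)

lemma completely_metrizable_fibre: "completely_metrizable_space (subtopology P (fibre y))"
proof (cases "y \<in> q ` topspace P")
  case True
  then show ?thesis
    unfolding fibre_def
    by (intro completely_metrizable_space_gdelta_in completely_metrizable gdelta_fibre)
next
  case False
  then have "fibre y = {}" by (auto simp: fibre_def)
  then show ?thesis by (simp add: empty_completely_metrizable_space)
qed

lemma t0_quotient: "t0_space Y"
  unfolding t0_space_def
proof (intro ballI impI)
  fix y z assume yz: "y \<in> topspace Y" "z \<in> topspace Y" "y \<noteq> z"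
  show "\<exists>U. openin Y U \<and> (y \<notin> U \<longleftrightarrow> z \<in> U)"
  proof (rule ccontr)
    assume "\<nexists>U. openin Y U \<and> (y \<notin> U \<longleftrightarrow> z \<in> U)"
    then have "y \<in> q ` U \<longleftrightarrow> z \<in> q ` U" if "openin P U" for U
      using openin_image[OF that] by blast
    then have same: "U \<inter> fibre y \<noteq> {} \<longleftrightarrow> U \<inter> fibre z \<noteq> {}" if "openin P U" for U
      using that fibre_meets_iff by simp
    define C where "C = P closure_of fibre y"
    have meets_C: "U \<inter> C \<noteq> {} \<longleftrightarrow> U \<inter> fibre y \<noteq> {}" if "openin P U" for U
      using that openin_Int_closure_of_eq_empty[of P U "fibre y"] by (simp add: C_def)
    \<comment> \<open>An open set meeting \<open>C\<close> meets \<open>fibre y\<close>, hence also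
      \<open>fibre w\<close>. So each of the open sets whose intersection is \<open>fibre w\<close>
      is dense in \<open>C\<close>. This is used for both \<open>y\<close> and \<open>z\<close>, and
      disjoint fibres cannot both be comeager in \<open>C\<close>.\<close>
    have comeager: "rel_comeager P C (topspace P) (fibre w)"
      if w: "w \<in> topspace Y" "\<And>U. openin P U \<Longrightarrow> U \<inter> fibre y \<noteq> {} \<longleftrightarrow> U \<inter> fibre w \<noteq> {}" for w
    proof -
      have "gdelta_in P (fibre w)"
        using w(1) gdelta_fibre by (simp add: fibre_def)
      then obtain D :: "nat \<Rightarrow> 'a set" where D: "\<forall>n. openin P (D n)" "\<Inter>(range D) = fibre w"
        unfolding gdelta_in_descending by blast
      show ?thesis
      proof (rule rel_comeagerI[of P D])
        show "openin P (D n)" for n using D(1) by simp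
        show "x \<in> fibre w" if "\<And>n. x \<in> D n" for x
          using that D(2) by blast
        show "U \<inter> D n \<inter> C \<noteq> {}" if U: "openin P U" "U \<inter> C \<noteq> {}" for n U
        proof -
          have "U \<inter> fibre w \<noteq> {}" using U by (simp add: meets_C w(2))
          then have "U \<inter> D n \<inter> fibre w \<noteq> {}" using D(2) by blast
          moreover have "openin P (U \<inter> D n)" using U(1) D(1) by auto
          ultimately show ?thesis by (simp add: meets_C w(2))
        qed
      qed
    qed
    have "C \<subseteq> topspace P"
      unfolding C_def by (rule closure_of_subset_topspace)
    moreover have "fibre y \<noteq> {}"
      using yz(1) by (auto simp: fibre_def)
    then have "topspace P \<inter> C \<noteq> {}"
      using meets_C[OF openin_topspace] fibre_subset[of y] by (simp add: Int_absorb1)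
    moreover have "completely_metrizable_space (subtopology P C)"
      unfolding C_def by (intro completely_metrizable_space_closedin completely_metrizable) simp
    ultimately have "topspace P \<inter> C \<inter> (fibre y \<inter> fibre z) \<noteq> {}"
      using comeager[OF yz(1) refl] comeager[OF yz(2) same]
      by (intro rel_comeager_nonempty rel_comeager_Int) simp_all
    then show False
      using yz(3) by (auto simp: fibre_def)
  qed
qed

end

subsection \<open>The category quantifier over the fibres\<close>

locale based_open_polish_quotient = open_polish_quotient +
  fixes B :: "nat \<Rightarrow> 'a set"
  assumes openin_base: "openin P (B n)"
    and base: "openin P U \<Longrightarrow> x \<in> U \<Longrightarrow> \<exists>n. x \<in> B n \<and> B n \<subseteq> U"
begin

lemma base_image: "openin P U \<Longrightarrow> y \<in> q ` U \<Longrightarrow> \<exists>n. B n \<subseteq> U \<and> y \<in> q ` B n"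
  using base by blast

lemma base_meets:
  "openin P U \<Longrightarrow> U \<inter> fibre y \<noteq> {} \<Longrightarrow> \<exists>n. B n \<subseteq> U \<and> y \<in> q ` B n"
  by (simp add: fibre_meets_iff base_image)

text \<open>A form of the Baire property of the trace of \<open>A\<close> on all fibres.\<close>

definition fibrewise_baire :: "'a set \<Rightarrow> bool" where
  "fibrewise_baire A \<longleftrightarrow>
     (\<forall>y V. openin P V \<longrightarrow> rel_comeager P (fibre y) V (topspace P - A) \<or>
       (\<exists>n. B n \<subseteq> V \<and> y \<in> q ` B n \<and> rel_comeager P (fibre y) (B n) A))"

definition comeager_points :: "'a set \<Rightarrow> 'a set \<Rightarrow> 'b set" where
  "comeager_points V A = {y \<in> topspace Y. rel_comeager P (fibre y) V A}"

lemma not_comeager_both: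
  assumes "openin P V" "y \<in> q ` V" "rel_comeager P (fibre y) V A"
  shows "\<not> rel_comeager P (fibre y) V (topspace P - A)"
proof
  assume "rel_comeager P (fibre y) V (topspace P - A)"
  with assms(3) have "rel_comeager P (fibre y) V (A \<inter> (topspace P - A))"
    by (rule rel_comeager_Int)
  then have "V \<inter> fibre y \<inter> (A \<inter> (topspace P - A)) \<noteq> {}"
    using assms(1,2) fibre_subset completely_metrizable_fibre
    by (intro rel_comeager_nonempty) (simp_all add: fibre_meets_iff)
  then show False by blast
qed

text \<open>If the complement of \<open>A\<close> is comeager in no base set inside \<open>V\<close>
  that meets the fibre, then the property of \<open>A\<close> yields, inside every open subset of
  \<open>V\<close> meeting the fibre, a base set where \<open>A\<close> is comeager. Such base sets
  are dense in \<open>V\<close>, so locality makes \<open>A\<close> comeager in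
  \<open>V\<close>.\<close>

lemma fibrewise_baire_Compl:
  assumes A: "fibrewise_baire A"
  shows "fibrewise_baire (topspace P - A)"
  unfolding fibrewise_baire_def
proof (intro allI impI)
  fix y V assume V: "openin P V"
  let ?F = "fibre y"
  show "rel_comeager P ?F V (topspace P - (topspace P - A)) \<or>
      (\<exists>n. B n \<subseteq> V \<and> y \<in> q ` B n \<and> rel_comeager P ?F (B n) (topspace P - A))"
  proof (rule disjCI)
    assume no: "\<not> (\<exists>n. B n \<subseteq> V \<and> y \<in> q ` B n \<and> rel_comeager P ?F (B n) (topspace P - A))"
    \<comment> \<open>Indices where \<open>A\<close> is not comeager get the empty set, in which
      comeagerness is vacuous.\<close>
    define W where "W n = (if rel_comeager P ?F (B n) A then B n else {})" for n
    have "rel_comeager P ?F V A"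
    proof (rule rel_comeager_local[where W = W])
      show "openin P (W n)" for n
        by (simp add: W_def openin_base)
      show "rel_comeager P ?F (W n) A" for n
        by (auto simp: W_def intro: rel_comeager_superset)
      show "?F \<subseteq> topspace P" by (rule fibre_subset)
      fix U assume U: "openin P U" "U \<subseteq> V" "U \<inter> ?F \<noteq> {}"
      have "\<not> rel_comeager P ?F U (topspace P - A)"
      proof
        assume c: "rel_comeager P ?F U (topspace P - A)"
        obtain n where n: "B n \<subseteq> U" "y \<in> q ` B n"
          using base_meets[OF U(1,3)] by blast
        show False
          using no n U(2) rel_comeager_antimono[OF c n(1)] by blast
      qed
      then obtain n where n: "B n \<subseteq> U" "y \<in> q ` B n" "rel_comeager P ?F (B n) A"
        using A U(1) unfolding fibrewise_baire_def by blast
      then have "B n \<inter> ?F \<noteq> {}"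
        by (simp add: fibre_meets_iff openin_base)
      then have "U \<inter> W n \<inter> ?F \<noteq> {}"
        using n by (auto simp: W_def)
      then show "\<exists>n. U \<inter> W n \<inter> ?F \<noteq> {}" ..
    qed
    then show "rel_comeager P ?F V (topspace P - (topspace P - A))"
      by (rule rel_comeager_mono) (use fibre_subset in auto)
  qed
qed

text \<open>From left to right, \<open>A\<close> and its complement cannot both be comeager in a
  nonempty open part of the fibre; from right to left, this is the Baire property. The equivalence
  turns complements into a countable Boolean operation, which keeps the sets of comeager points
  Borel.\<close>

lemma comeager_Compl_iff:
  assumes "fibrewise_baire A" "openin P V"
  shows "rel_comeager P (fibre y) V (topspace P - A) \<longleftrightarrow>
    (\<forall>n. B n \<subseteq> V \<and> y \<in> q ` B n \<longrightarrow> \<not> rel_comeager P (fibre y) (B n) A)"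
    (is "?L \<longleftrightarrow> ?R")
proof
  assume L: ?L
  show ?R
  proof (intro allI impI)
    fix n assume n: "B n \<subseteq> V \<and> y \<in> q ` B n"
    then have "rel_comeager P (fibre y) (B n) (topspace P - A)"
      using L rel_comeager_antimono by blast
    then show "\<not> rel_comeager P (fibre y) (B n) A"
      using not_comeager_both openin_base n by blast
  qed
next
  assume ?R
  then show ?L using assms unfolding fibrewise_baire_def by blast
qed

lemma comeager_points_Compl:
  assumes "fibrewise_baire A" "openin P V"
    and meas: "\<And>n. comeager_points (B n) A \<in> sets (borel_of Y)"
  shows "comeager_points V (topspace P - A) \<in> sets (borel_of Y)"
proof -
  have "q ` B n \<in> sets (borel_of Y)" for n
    by (intro openin_imp_borel_of openin_image openin_base)
  then have "topspace Y - (\<Union>n\<in>{n. B n \<subseteq> V}. q ` B n \<inter> comeager_points (B n) A) \<in> sets (borel_of Y)"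
    using meas openin_imp_borel_of[OF openin_topspace, of Y]
    by (intro sets.Diff sets.countable_UN'' sets.Int) simp_all
  also have "topspace Y - (\<Union>n\<in>{n. B n \<subseteq> V}. q ` B n \<inter> comeager_points (B n) A) =
      comeager_points V (topspace P - A)"
    unfolding comeager_points_def comeager_Compl_iff[OF assms(1,2)] by auto
  finally show ?thesis .
qed

lemma fibrewise_baire_open:
  assumes A: "openin P A"
  shows "fibrewise_baire A"
  unfolding fibrewise_baire_def
proof (intro allI impI)
  fix y V assume V: "openin P V"
  show "rel_comeager P (fibre y) V (topspace P - A) \<or>
      (\<exists>n. B n \<subseteq> V \<and> y \<in> q ` B n \<and> rel_comeager P (fibre y) (B n) A)"
  proof (cases "V \<inter> A \<inter> fibre y = {}")
    case True
    then have "rel_comeager P (fibre y) V (topspace P - A)"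
      using V fibre_subset[of y] by (intro rel_comeager_superset) auto
    then show ?thesis ..
  next
    case False
    have VA: "openin P (V \<inter> A)" using V A by auto
    then obtain n where n: "B n \<subseteq> V \<inter> A" "y \<in> q ` B n"
      using base_meets False by blast
    then have "rel_comeager P (fibre y) (B n) A"
      using openin_base by (intro rel_comeager_superset) auto
    then show ?thesis using n by blast
  qed
qed

text \<open>An open set is comeager in a fibre exactly when it is dense there, by Baire, and density
  need only be tested on base sets. The condition thus involves countably many sets \<open>q\<close>
  B n\<open>and\<close>q \<open>(B n \<inter> A)\<close>, all open in the quotient.\<close>

lemma comeager_points_open:
  assumes A: "openin P A" and V: "openin P V"
  shows "comeager_points V A \<in> sets (borel_of Y)"
proof -
  have "rel_comeager P (fibre y) V A \<longleftrightarrow> (\<forall>n. B n \<subseteq> V \<and> y \<in> q ` B n \<longrightarrow> y \<in> q ` (B n \<inter> A))"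
    (is "?L \<longleftrightarrow> ?R") for y
  proof
    assume ?L
    show ?R
    proof (intro allI impI)
      fix n assume n: "B n \<subseteq> V \<and> y \<in> q ` B n"
      have "rel_comeager P (fibre y) (B n) A"
        using n \<open>?L\<close> rel_comeager_antimono by blast
      then have "B n \<inter> fibre y \<inter> A \<noteq> {}"
        using n by (intro rel_comeager_nonempty[OF completely_metrizable_fibre fibre_subset])
          (simp_all add: fibre_meets_iff openin_base)
      then have "(B n \<inter> A) \<inter> fibre y \<noteq> {}" by blast
      then show "y \<in> q ` (B n \<inter> A)"
        using openin_base A by (simp add: fibre_meets_iff openin_Int)
    qed
  next
    assume R: ?R
    show ?L
    proof (rule rel_comeager_open[OF A])
      fix W assume W: "openin P W" "W \<subseteq> V" "W \<inter> fibre y \<noteq> {}"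
      then obtain n where n: "B n \<subseteq> W" "y \<in> q ` B n"
        using base_meets by blast
      then have "y \<in> q ` (B n \<inter> A)" using R W(2) by blast
      then have "B n \<inter> A \<inter> fibre y \<noteq> {}"
        using openin_base A by (simp add: fibre_meets_iff openin_Int)
      then show "W \<inter> A \<inter> fibre y \<noteq> {}" using n(1) by blast
    qed
  qed
  then have "comeager_points V A =
      topspace Y - (\<Union>n\<in>{n. B n \<subseteq> V}. q ` B n - q ` (B n \<inter> A))"
    unfolding comeager_points_def by auto
  moreover have "q ` B n \<in> sets (borel_of Y)" "q ` (B n \<inter> A) \<in> sets (borel_of Y)" for n
    by (intro openin_imp_borel_of openin_image openin_Int openin_base A)+
  ultimately show ?thesis
    using openin_imp_borel_of[OF openin_topspace, of Y]
    by (auto simp del: topspace_quotient_topology intro!: sets.Diff sets.countable_UN'')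
qed

text \<open>Both claims are carried through one induction, and for all \<open>V\<close> at once,
  because the complement step for a given \<open>V\<close> needs the Baire property of
  \<open>A\<close> and the comeager points of \<open>A\<close> in every base set.\<close>

lemma borel_fibrewise_baire:
  assumes "A \<in> sets (borel_of P)"
  shows "fibrewise_baire A \<and> (\<forall>V. openin P V \<longrightarrow> comeager_points V A \<in> sets (borel_of Y))"
  using assms[unfolded sets_borel_of]
proof (induction rule: sigma_sets.induct)
  case (Basic A)
  then show ?case by (simp add: fibrewise_baire_open comeager_points_open)
next
  case Empty
  show ?case by (simp add: fibrewise_baire_open comeager_points_open)
next
  case (Compl A)
  then show ?case by (simp add: fibrewise_baire_Compl comeager_points_Compl openin_base)
next
  case (Union A)
  \<comment> \<open>Comeagerness distributes over countable intersections but not over unions, so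
    the union is handled through its complement.\<close>
  have compl: "topspace P - (\<Union>i. A i) = (\<Inter>i. topspace P - A i)" by auto
  have INT_iff: "rel_comeager P F V (topspace P - (\<Union>i. A i)) \<longleftrightarrow>
      (\<forall>i. rel_comeager P F V (topspace P - A i))" for F V
  proof (intro iffI allI)
    show "rel_comeager P F V (topspace P - A i)"
      if "rel_comeager P F V (topspace P - (\<Union>i. A i))" for i
      using that by (rule rel_comeager_mono) auto
    show "rel_comeager P F V (topspace P - (\<Union>i. A i))"
      if "\<forall>i. rel_comeager P F V (topspace P - A i)"
      unfolding compl by (rule rel_comeager_INT) (use that in simp)
  qed
  have baire: "fibrewise_baire (\<Union>i. A i)"
    unfolding fibrewise_baire_def
  proof (intro allI impI disjCI)
    fix y V assume V: "openin P V" and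
      no: "\<not> (\<exists>n. B n \<subseteq> V \<and> y \<in> q ` B n \<and> rel_comeager P (fibre y) (B n) (\<Union>i. A i))"
    have "rel_comeager P (fibre y) V (topspace P - A i)" for i
    proof (rule ccontr)
      assume "\<not> rel_comeager P (fibre y) V (topspace P - A i)"
      then obtain n where n: "B n \<subseteq> V" "y \<in> q ` B n" "rel_comeager P (fibre y) (B n) (A i)"
        using Union.IH[of i] V unfolding fibrewise_baire_def by blast
      from n(3) have "rel_comeager P (fibre y) (B n) (\<Union>i. A i)"
        by (rule rel_comeager_mono) auto
      then show False using no n by blast
    qed
    then show "rel_comeager P (fibre y) V (topspace P - (\<Union>i. A i))"
      by (simp add: INT_iff)
  qed
  have "comeager_points V (\<Union>i. A i) \<in> sets (borel_of Y)" if V: "openin P V" for V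
  proof -
    have "comeager_points (B n) (topspace P - A i) \<in> sets (borel_of Y)" for i n
      using Union.IH[of i] openin_base by (intro comeager_points_Compl) auto
    moreover have "comeager_points (B n) (topspace P - (\<Union>i. A i)) =
        (\<Inter>i. comeager_points (B n) (topspace P - A i))" for n
      unfolding comeager_points_def by (auto simp: INT_iff)
    ultimately have "comeager_points (B n) (topspace P - (\<Union>i. A i)) \<in> sets (borel_of Y)" for n
      by auto
    \<comment> \<open>A second complement leads back to the union, since fibres lie inside the
      space.\<close>
    from comeager_points_Compl[OF fibrewise_baire_Compl[OF baire] V this]
    have "comeager_points V (topspace P - (topspace P - (\<Union>i. A i))) \<in> sets (borel_of Y)" .
    moreover have "rel_comeager P (fibre y) V (topspace P - (topspace P - (\<Union>i. A i))) \<longleftrightarrow>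
        rel_comeager P (fibre y) V (\<Union>i. A i)" for y
      using fibre_subset[of y] by (auto elim!: rel_comeager_mono)
    ultimately show ?thesis by (simp add: comeager_points_def)
  qed
  with baire show ?case by blast
qed

lemma quotient_borel_sets_eq: "quotient_borel_sets P q = sets (borel_of Y)"
proof (intro equalityI subsetI)
  fix S assume S: "S \<in> sets (borel_of Y)"
  from sets.sets_into_space[OF this] have sub: "S \<subseteq> topspace Y"
    by simp
  have "q \<in> measurable (borel_of P) (borel_of Y)"
    by (intro continuous_map_measurable_borel_of quotient_imp_continuous_map
        quotient_map_quotient_topology)
  from measurable_sets[OF this S] have "q -` S \<inter> space (borel_of P) \<in> sets (borel_of P)" .
  moreover have "q -` S \<inter> space (borel_of P) = {x \<in> topspace P. q x \<in> S}" by auto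
  ultimately show "S \<in> quotient_borel_sets P q"
    using sub by (simp add: quotient_borel_sets_def)
next
  fix S assume "S \<in> quotient_borel_sets P q"
  then have S: "S \<subseteq> topspace Y" "{x \<in> topspace P. q x \<in> S} \<in> sets (borel_of P)"
    by (auto simp: quotient_borel_sets_def)
  let ?A = "{x \<in> topspace P. q x \<in> S}"
  \<comment> \<open>A saturated set contains a fibre or misses it, and by Baire the empty set is not
    comeager in a nonempty fibre.\<close>
  have "rel_comeager P (fibre y) (topspace P) ?A \<longleftrightarrow> y \<in> S" if y: "y \<in> topspace Y" for y
  proof
    assume "y \<in> S"
    then show "rel_comeager P (fibre y) (topspace P) ?A"
      by (intro rel_comeager_superset) (auto simp: fibre_def)
  next
    assume "rel_comeager P (fibre y) (topspace P) ?A"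
    then have "topspace P \<inter> fibre y \<inter> ?A \<noteq> {}"
      using y by (intro rel_comeager_nonempty[OF completely_metrizable_fibre fibre_subset])
        (auto simp: fibre_def)
    then show "y \<in> S" by (auto simp: fibre_def)
  qed
  then have "comeager_points (topspace P) ?A = S"
    using S(1) by (auto simp: comeager_points_def)
  then show "S \<in> sets (borel_of Y)"
    using borel_fibrewise_baire[OF S(2)] by auto
qed

end

subsection \<open>Cantor space\<close>

definition cantor :: "(nat \<Rightarrow> bool) topology" where
  "cantor = product_topology (\<lambda>_. discrete_topology UNIV) UNIV"

definition cylinder :: "bool list \<Rightarrow> (nat \<Rightarrow> bool) set" where
  "cylinder s = {f. \<forall>i<length s. f i = s ! i}"

lemma topspace_cantor [simp]: "topspace cantor = UNIV"
  by (simp add: cantor_def)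

lemma openin_cantor_coordinate: "openin cantor {f. f n \<in> A}"
proof -
  have "continuous_map cantor (discrete_topology UNIV) (\<lambda>f. f n)"
    unfolding cantor_def by (rule continuous_map_product_projection) simp
  then have "openin cantor {f \<in> topspace cantor. f n \<in> A}"
    by (rule openin_continuous_map_preimage) simp
  then show ?thesis by simp
qed

lemma openin_cantor_True: "openin cantor {f. f n}"
  and openin_cantor_False: "openin cantor {f. \<not> f n}"
  using openin_cantor_coordinate[of n "{True}"] openin_cantor_coordinate[of n "{False}"] by simp_all

lemma openin_cylinder: "openin cantor (cylinder s)"
proof -
  have "cylinder s = (\<Inter>i<length s. {f. f i \<in> {s ! i}}) \<inter> topspace cantor"
    by (auto simp: cylinder_def)
  also have "openin cantor \<dots>"
    by (intro openin_INT openin_cantor_coordinate) simp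
  finally show ?thesis .
qed

lemma cylinder_base:
  assumes "openin cantor U" "f \<in> U"
  shows "\<exists>s. f \<in> cylinder s \<and> cylinder s \<subseteq> U"
proof -
  obtain W where W: "finite {i. W i \<noteq> UNIV}" "f \<in> Pi\<^sub>E UNIV W" "Pi\<^sub>E UNIV W \<subseteq> U"
    using assms unfolding cantor_def openin_product_topology_alt by auto
  \<comment> \<open>Cylinders fix an initial segment, so the finitely many restricted coordinates
    are enclosed in one.\<close>
  obtain N where N: "\<forall>i\<in>{i. W i \<noteq> UNIV}. i < N"
    using W(1) finite_nat_set_iff_bounded by blast
  have "cylinder (map f [0..<N]) \<subseteq> U"
  proof
    fix g assume "g \<in> cylinder (map f [0..<N])"
    then have "g i = f i" if "i < N" for i using that by (simp add: cylinder_def)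
    then have "g i \<in> W i" for i
      using W(2) N by (cases "W i = UNIV") (auto simp: PiE_iff)
    then show "g \<in> U" using W(3) by (auto simp: PiE_iff)
  qed
  moreover have "f \<in> cylinder (map f [0..<N])" by (simp add: cylinder_def)
  ultimately show ?thesis by blast
qed

lemma openin_cantor_eq_Union_cylinder:
  assumes "openin cantor U"
  shows "U = (\<Union>s\<in>{s. cylinder s \<subseteq> U}. cylinder s)"
proof (intro equalityI subsetI)
  fix f assume "f \<in> U"
  then obtain s where "f \<in> cylinder s" "cylinder s \<subseteq> U"
    using cylinder_base[OF assms] by blast
  then show "f \<in> (\<Union>s\<in>{s. cylinder s \<subseteq> U}. cylinder s)" by auto
qed auto

lemma second_countable_cantor: "second_countable cantor"
  unfolding second_countable_def
proof (intro exI conjI)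
  show "countable (range cylinder)" by simp
  show "\<forall>V\<in>range cylinder. openin cantor V" by (simp add: openin_cylinder)
  show "\<forall>U x. openin cantor U \<and> x \<in> U \<longrightarrow> (\<exists>V\<in>range cylinder. x \<in> V \<and> V \<subseteq> U)"
    using cylinder_base by (metis rangeI)
qed

lemma completely_metrizable_cantor: "completely_metrizable_space cantor"
  unfolding cantor_def completely_metrizable_space_product_topology
  by (simp add: completely_metrizable_space_discrete_topology)

text \<open>This peels countable universal quantifiers off a condition one at a time, down to an
  open matrix.\<close>

lemma gdelta_in_Collect_all:
  assumes "\<And>i::'i::countable. gdelta_in T {x \<in> topspace T. Q i x}"
  shows "gdelta_in T {x \<in> topspace T. \<forall>i. Q i x}"
proof -
  have "gdelta_in T (\<Inter>i. {x \<in> topspace T. Q i x})"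
    by (rule gdelta_in_Inter) (use assms in auto)
  moreover have "(\<Inter>i. {x \<in> topspace T. Q i x}) = {x \<in> topspace T. \<forall>i. Q i x}"
    by auto
  ultimately show ?thesis by simp
qed

subsection \<open>The quotient as a \<open>G\<^sub>\<delta>\<close> subset of Cantor space\<close>

context based_open_polish_quotient
begin

definition code :: "'b \<Rightarrow> nat \<Rightarrow> bool" where
  "code y n \<longleftrightarrow> y \<in> q ` B n"

lemma openin_Y_eq_Union:
  assumes "openin Y U"
  shows "U = (\<Union>n\<in>{n. q ` B n \<subseteq> U}. q ` B n)"
proof -
  have "openin P {x \<in> topspace P. q x \<in> U}" and U: "U \<subseteq> q ` topspace P"
    using assms by (auto simp: openin_quotient_topology)
  then have "\<exists>n. x \<in> B n \<and> B n \<subseteq> {x \<in> topspace P. q x \<in> U}" if "x \<in> topspace P" "q x \<in> U" for x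
    using base that by blast
  then have "\<exists>n. y \<in> q ` B n \<and> q ` B n \<subseteq> U" if "y \<in> U" for y
    using U that by (smt (verit, best) image_iff image_subset_iff mem_Collect_eq subset_iff)
  then show ?thesis by blast
qed

lemma inj_on_code: "inj_on code (topspace Y)"
proof (rule inj_onI, rule ccontr)
  fix y z assume yz: "y \<in> topspace Y" "z \<in> topspace Y" "code y = code z" "y \<noteq> z"
  then obtain U where U: "openin Y U" "y \<notin> U \<longleftrightarrow> z \<in> U"
    using t0_quotient unfolding t0_space_def by blast
  have "y \<in> q ` B n \<longleftrightarrow> z \<in> q ` B n" for n
    using fun_cong[OF yz(3), of n] by (simp add: code_def)
  then have "y \<in> (\<Union>n\<in>{n. q ` B n \<subseteq> U}. q ` B n) \<longleftrightarrow> z \<in> (\<Union>n\<in>{n. q ` B n \<subseteq> U}. q ` B n)"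
    by simp
  then show False
    using U openin_Y_eq_Union[OF U(1)] by simp
qed

text \<open>The codes of points are the sets \<open>{n. f n}\<close> of indices that are closed upwards and contain, below
  any two of their members, arbitrarily small ones; completeness turns such a set into a point of
  \<open>P\<close>. Each condition is an implication between open conditions whose premise is clopen.\<close>

lemma gdelta_range_code: "gdelta_in cantor (code ` topspace Y)"
proof -
  obtain M d where "Metric_space M d" and mc: "Metric_space.mcomplete M d"
    and P: "P = Metric_space.mtopology M d"
    using completely_metrizable unfolding completely_metrizable_space_def by blast
  then interpret Metric_space M d by simp
  have top: "topspace P = M" by (simp add: P)
  \<comment> \<open>\<open>R n i k m\<close> makes \<open>B m\<close> a successor of
    \<open>B n\<close> in a convergent nested sequence: its closure stays in \<open>B n\<close>, its
    image goes below that of \<open>B i\<close>, and its size is controlled by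
    \<open>k\<close>.\<close>
  define R where "R n i k m \<longleftrightarrow> P closure_of B m \<subseteq> B n \<and> q ` B m \<subseteq> q ` B i \<and>
    (\<exists>a. B m \<subseteq> mcball a (1 / real (Suc k)))" for n i k m
  define good where "good f \<longleftrightarrow> (\<exists>n. f n) \<and> (\<forall>n. f n \<longrightarrow> B n \<noteq> {}) \<and>
      (\<forall>n i k. f n \<and> f i \<longrightarrow> (\<exists>m. f m \<and> R n i k m)) \<and>
      (\<forall>m n. q ` B m \<subseteq> q ` B n \<and> f m \<longrightarrow> f n)" for f
  have sound: "good (code y)" if y: "y \<in> topspace Y" for y
  proof -
    have "\<exists>n. code y n"
      using base_image[of "topspace P" y] y by (auto simp: code_def)
    moreover have "\<forall>n. code y n \<longrightarrow> B n \<noteq> {}"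
      by (auto simp: code_def)
    moreover have "\<forall>m n. q ` B m \<subseteq> q ` B n \<and> code y m \<longrightarrow> code y n"
      by (auto simp: code_def)
    moreover have "\<exists>m. code y m \<and> R n i k m" if ni: "code y n" "code y i" for n i k
    proof -
      obtain x where x: "x \<in> B n" "q x = y"
        using ni by (auto simp: code_def)
      \<comment> \<open>This is the part of \<open>B n\<close> whose classes also meet
        \<open>B i\<close>; it is a neighbourhood of \<open>x\<close> because \<open>y\<close> lies
        in both images.\<close>
      let ?W = "B n \<inter> {x \<in> topspace P. q x \<in> q ` B i}"
      have W: "openin P ?W" by (intro openin_Int openin_base openin_saturation)
      have xW: "x \<in> ?W"
        using x ni(2) openin_subset[OF openin_base[of n]] by (auto simp: code_def)
      obtain r where r: "r > 0" "mball x r \<subseteq> ?W"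
        using W xW unfolding P openin_mtopology by blast
      \<comment> \<open>A radius strictly below \<open>r\<close> puts the closed ball of radius
        \<open>s\<close> inside the open ball of radius \<open>r\<close>; the other bound is the
        size demanded by \<open>R\<close>.\<close>
      define s where "s = min (r / 2) (1 / real (Suc k))"
      have s: "s > 0" "s < r" "s \<le> 1 / real (Suc k)"
        using r(1) by (auto simp: s_def min_def)
      have xM: "x \<in> M" using xW top by simp
      obtain m where m: "x \<in> B m" "B m \<subseteq> mball x s"
        using base[of "mball x s" x] xM s(1) by (auto simp: P)
      have "B m \<subseteq> mcball x s"
        using m(2) mball_subset_mcball by blast
      then have "P closure_of B m \<subseteq> mcball x s"
        unfolding P by (intro closure_of_minimal closedin_mcball)
      also have "\<dots> \<subseteq> mball x r"
        using s(2) by (rule mcball_subset_mball_concentric)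
      finally have cl: "P closure_of B m \<subseteq> ?W" using r(2) by blast
      have "B m \<subseteq> P closure_of B m"
        by (intro closure_of_subset openin_subset openin_base)
      then have "q ` B m \<subseteq> q ` B i" using cl by blast
      moreover have "B m \<subseteq> mcball x (1 / real (Suc k))"
        using \<open>B m \<subseteq> mcball x s\<close> mcball_subset_concentric[OF s(3)] by blast
      ultimately have "R n i k m"
        unfolding R_def using cl by blast
      moreover have "code y m" using m(1) x(2) by (auto simp: code_def)
      ultimately show ?thesis by blast
    qed
    ultimately show ?thesis by (simp add: good_def)
  qed
  have complete: "f \<in> code ` topspace Y" if f: "good f" for f
  proof -
    have ne: "{n. f n} \<noteq> {}" using f by (auto simp: good_def)
    define e where "e = from_nat_into {n. f n}"
    have e: "range e = {n. f n}"
      unfolding e_def by (rule range_from_nat_into) (use ne in auto)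
    have "\<exists>k. \<forall>j. f (k j) \<and> R (k j) (e j) j (k (Suc j))"
    proof (rule dependent_nat_choice)
      show "\<exists>n. f n" using f by (simp add: good_def)
      show "\<exists>m. f m \<and> R n (e j) j m" if "f n" for n j
      proof -
        have "f (e j)" using e by blast
        then show ?thesis using f that by (simp add: good_def)
      qed
    qed
    then obtain k where k: "\<And>j. f (k j)" "\<And>j. R (k j) (e j) j (k (Suc j))" by blast
    define C where "C j = P closure_of B (k j)" for j
    have B_C: "B (k j) \<subseteq> C j" for j
      unfolding C_def by (intro closure_of_subset openin_subset openin_base)
    have C_B: "C (Suc j) \<subseteq> B (k j)" for j
      using k(2)[of j] by (simp add: R_def C_def)
    \<comment> \<open>Closed balls absorb the closure. The bound begins with \<open>C 1\<close>,
      since the initial set \<open>B (k 0)\<close> is arbitrary.\<close>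
    have small: "\<exists>a. C (Suc j) \<subseteq> mcball a (1 / real (Suc j))" for j
    proof -
      obtain a where "B (k (Suc j)) \<subseteq> mcball a (1 / real (Suc j))"
        using k(2)[of j] by (auto simp: R_def)
      then have "C (Suc j) \<subseteq> mcball a (1 / real (Suc j))"
        unfolding C_def P by (intro closure_of_minimal closedin_mcball)
      then show ?thesis ..
    qed
    have "\<exists>l. l \<in> M \<and> \<Inter>(range C) = {l}"
      using mc[unfolded mcomplete_nest_sing]
    proof (rule allE[of _ C], elim impE)
      show "(\<forall>n. closedin mtopology (C n)) \<and> (\<forall>n. C n \<noteq> {}) \<and> decseq C \<and>
          (\<forall>e>0. \<exists>n a. C n \<subseteq> mcball a e)"
      proof (intro conjI allI impI)
        show "closedin mtopology (C n)" for n by (simp add: C_def P)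
        show "C n \<noteq> {}" for n using B_C[of n] k(1)[of n] f by (auto simp: good_def)
        show "decseq C" by (rule decseq_SucI) (use B_C C_B in blast)
        fix \<epsilon> :: real assume "\<epsilon> > 0"
        then obtain j where j: "1 / real (Suc j) < \<epsilon>" using nat_approx_posE by blast
        then have "mcball a (1 / real (Suc j)) \<subseteq> mcball a \<epsilon>" for a
          by (intro mcball_subset_concentric) simp
        then show "\<exists>n a. C n \<subseteq> mcball a \<epsilon>" using small[of j] by blast
      qed
    qed
    then obtain l where l: "l \<in> M" "\<Inter>(range C) = {l}" by blast
    then have lC: "l \<in> C j" for j by blast
    then have lB: "l \<in> B (k j)" for j using C_B by blast
    have "code (q l) n \<longleftrightarrow> f n" for n
    proof
      assume "f n"
      then obtain j where "n = e j" using e by blast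
      then have "q ` B (k (Suc j)) \<subseteq> q ` B n" using k(2)[of j] by (simp add: R_def)
      then show "code (q l) n" using lB[of "Suc j"] by (auto simp: code_def)
    next
      assume "code (q l) n"
      \<comment> \<open>The saturation of \<open>B n\<close> is a neighbourhood of \<open>l\<close>,
        so it contains some small \<open>B (k (Suc j))\<close>; upward closure of \<open>f\<close>
        then yields \<open>f n\<close>.\<close>
      let ?W = "{x \<in> topspace P. q x \<in> q ` B n}"
      have W: "openin P ?W" by (intro openin_saturation openin_base)
      have lW: "l \<in> ?W" using \<open>code (q l) n\<close> l(1) top by (simp add: code_def)
      obtain r where r: "r > 0" "mball l r \<subseteq> ?W"
        using W lW unfolding P openin_mtopology by blast
      \<comment> \<open>Two points of one closed ball of radius below \<open>r / 2\<close> are less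
        than \<open>r\<close> apart.\<close>
      obtain j where j: "1 / real (Suc j) < r / 2"
        using r(1) nat_approx_posE[of "r / 2"] by auto
      obtain a where a: "C (Suc j) \<subseteq> mcball a (1 / real (Suc j))" using small by blast
      have "B (k (Suc j)) \<subseteq> mball l r"
      proof
        fix x assume "x \<in> B (k (Suc j))"
        then have "x \<in> mcball a (1 / real (Suc j))" "l \<in> mcball a (1 / real (Suc j))"
          using a B_C lC by blast+
        then have "x \<in> M" "a \<in> M" "d a x \<le> 1 / real (Suc j)" "d a l \<le> 1 / real (Suc j)"
          by simp_all
        moreover from this have "d l x \<le> d a l + d a x"
          using triangle[of l a x] l(1) commute[of l a] by simp
        ultimately show "x \<in> mball l r" using j l(1) by simp
      qed
      then have "q ` B (k (Suc j)) \<subseteq> q ` B n" using r(2) by blast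
      with k(1) show "f n" using f unfolding good_def by blast
    qed
    then have "code (q l) = f" by auto
    moreover have "q l \<in> topspace Y" using l(1) top by simp
    ultimately show ?thesis by blast
  qed
  have "code ` topspace Y = {f \<in> topspace cantor. good f}"
  proof (intro equalityI subsetI)
    show "f \<in> {f \<in> topspace cantor. good f}" if "f \<in> code ` topspace Y" for f
      using that sound by (elim imageE) simp
    show "f \<in> code ` topspace Y" if "f \<in> {f \<in> topspace cantor. good f}" for f
      using that complete by simp
  qed
  also have "\<dots> = {f \<in> topspace cantor. \<exists>n. f n} \<inter> {f \<in> topspace cantor. \<forall>n. f n \<longrightarrow> B n \<noteq> {}} \<inter>
      {f \<in> topspace cantor. \<forall>n i k. f n \<and> f i \<longrightarrow> (\<exists>m. f m \<and> R n i k m)} \<inter>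
      {f \<in> topspace cantor. \<forall>m n. q ` B m \<subseteq> q ` B n \<and> f m \<longrightarrow> f n}"
    by (simp add: good_def Collect_conj_eq Int_assoc)
  also have "gdelta_in cantor \<dots>"
  proof (intro gdelta_in_Int gdelta_in_Collect_all open_imp_gdelta_in)
    have "{f \<in> topspace cantor. \<exists>n. f n} = (\<Union>n. {f. f n})" by auto
    then show "openin cantor {f \<in> topspace cantor. \<exists>n. f n}"
      by (simp only:) (auto intro: openin_cantor_True)
    show "openin cantor {f \<in> topspace cantor. f n \<longrightarrow> B n \<noteq> {}}" for n
    proof -
      have "{f \<in> topspace cantor. f n \<longrightarrow> B n \<noteq> {}} =
          (if B n = {} then {f. \<not> f n} else topspace cantor)"
        by auto
      then show ?thesis
        using openin_cantor_False openin_topspace[of cantor] by (simp del: topspace_cantor)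
    qed
    show "openin cantor {f \<in> topspace cantor. q ` B m \<subseteq> q ` B n \<and> f m \<longrightarrow> f n}" for m n
    proof -
      have "{f \<in> topspace cantor. q ` B m \<subseteq> q ` B n \<and> f m \<longrightarrow> f n} =
          (if q ` B m \<subseteq> q ` B n then {f. \<not> f m} \<union> {f. f n} else topspace cantor)"
        by auto
      then show ?thesis
        using openin_topspace[of cantor] openin_Un[OF openin_cantor_False openin_cantor_True]
        by (simp del: topspace_cantor)
    qed
    show "openin cantor {f \<in> topspace cantor. f n \<and> f i \<longrightarrow> (\<exists>m. f m \<and> R n i k m)}" for n i k
    proof -
      have "{f \<in> topspace cantor. f n \<and> f i \<longrightarrow> (\<exists>m. f m \<and> R n i k m)} =
          {f. \<not> f n} \<union> {f. \<not> f i} \<union> (\<Union>m\<in>{m. R n i k m}. {f. f m})"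
        by auto
      then show ?thesis
        by (simp only:) (intro openin_Un openin_Union ballI openin_cantor_False; auto intro: openin_cantor_True)
    qed
  qed
  finally show ?thesis .
qed

section \<open>The Polish topology refining the quotient topology\<close>

definition refined_topology :: "'b topology" where
  "refined_topology = pullback_topology (topspace Y) code cantor"

lemma topspace_refined [simp]: "topspace refined_topology = topspace Y"
  by (simp add: refined_topology_def topspace_pullback_topology)

lemma openin_refined: "openin Y U \<Longrightarrow> openin refined_topology U"
proof -
  assume U: "openin Y U"
  have "openin refined_topology (q ` B n)" for n
  proof -
    have "q ` B n = code -` {f. f n} \<inter> topspace Y"
      using openin_subset[OF openin_image[OF openin_base]] by (auto simp: code_def)
    then show ?thesis
      unfolding refined_topology_def openin_pullback_topology using openin_cantor_True by blast
  qed
  then have "openin refined_topology (\<Union>n\<in>{n. q ` B n \<subseteq> U}. q ` B n)" by blast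
  then show ?thesis using openin_Y_eq_Union[OF U] by simp
qed

lemma openin_refined_imp_borel:
  assumes "openin refined_topology S"
  shows "S \<in> sets (borel_of Y)"
proof -
  obtain U where U: "openin cantor U" and S: "S = code -` U \<inter> topspace Y"
    using assms unfolding refined_topology_def openin_pullback_topology by blast
  have "q ` B n \<in> sets (borel_of Y)" for n
    by (intro openin_imp_borel_of openin_image openin_base)
  moreover have Y: "topspace Y \<in> sets (borel_of Y)"
    by (intro openin_imp_borel_of openin_topspace)
  ultimately have cell: "(if b then q ` B n else topspace Y - q ` B n) \<in> sets (borel_of Y)" for b n
    by (auto simp del: topspace_quotient_topology)
  have "topspace Y \<inter> (\<Inter>i\<in>{..<length s}. if s ! i then q ` B i else topspace Y - q ` B i)
      \<in> sets (borel_of Y)" for s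
  \<comment> \<open>For the empty list the intersection is the whole type, and only
    \<open>topspace Y\<close> remains.\<close>
  proof (cases "s = []")
    case False
    then show ?thesis
      using Y cell by (intro sets.Int sets.finite_INT) auto
  qed (use Y in simp)
  moreover have "code -` cylinder s \<inter> topspace Y =
      topspace Y \<inter> (\<Inter>i\<in>{..<length s}. if s ! i then q ` B i else topspace Y - q ` B i)" for s
    by (auto simp: cylinder_def code_def split: if_splits)
  ultimately have "code -` cylinder s \<inter> topspace Y \<in> sets (borel_of Y)" for s
    by simp
  then have "(\<Union>s\<in>{s. cylinder s \<subseteq> U}. code -` cylinder s \<inter> topspace Y) \<in> sets (borel_of Y)"
    by (intro sets.countable_UN'') auto
  moreover have "S = (\<Union>s\<in>{s. cylinder s \<subseteq> U}. code -` cylinder s \<inter> topspace Y)"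
    unfolding S by (subst openin_cantor_eq_Union_cylinder[OF U]) auto
  ultimately show ?thesis by simp
qed

lemma sets_borel_refined: "sets (borel_of refined_topology) = sets (borel_of Y)"
proof (rule antisym)
  show "sets (borel_of refined_topology) \<subseteq> sets (borel_of Y)"
    unfolding sets_borel_of[of refined_topology] topspace_refined
    by (subst space_borel_of[symmetric], rule sets.sigma_sets_subset)
      (auto intro: openin_refined_imp_borel)
  show "sets (borel_of Y) \<subseteq> sets (borel_of refined_topology)"
    unfolding sets_borel_of topspace_refined
    by (rule sigma_sets_mono') (auto intro: openin_refined)
qed

lemma polish_refined: "polish_topology refined_topology"
proof -
  let ?C = "subtopology cantor (code ` topspace Y)"
  have "homeomorphic_map refined_topology ?C code"
  proof (rule bijective_open_imp_homeomorphic_map)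
    show "continuous_map refined_topology ?C code"
      unfolding continuous_map_in_subtopology
    proof
      show "continuous_map refined_topology cantor code"
        unfolding continuous_map_def
      proof (intro conjI allI impI)
        fix U assume "openin cantor U"
        moreover have "{x \<in> topspace refined_topology. code x \<in> U} = code -` U \<inter> topspace Y"
          by auto
        ultimately show "openin refined_topology {x \<in> topspace refined_topology. code x \<in> U}"
          unfolding refined_topology_def openin_pullback_topology by blast
      qed simp
    qed simp
    show "open_map refined_topology ?C code"
      unfolding open_map_def
    proof (intro allI impI)
      fix S assume "openin refined_topology S"
      then obtain U where "openin cantor U" "S = code -` U \<inter> topspace Y"
        unfolding refined_topology_def openin_pullback_topology by blast
      moreover from this have "code ` S = U \<inter> code ` topspace Y" by auto
      ultimately show "openin ?C (code ` S)"
        unfolding openin_subtopology by blast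
    qed
    show "code ` topspace refined_topology = topspace ?C" by simp
    show "inj_on code (topspace refined_topology)" using inj_on_code by simp
  qed
  then have hom: "?C homeomorphic_space refined_topology"
    using homeomorphic_map_imp_homeomorphic_space homeomorphic_space_sym by blast
  then have "completely_metrizable_space refined_topology"
    using homeomorphic_completely_metrizable_space gdelta_range_code
      completely_metrizable_space_gdelta_in completely_metrizable_cantor by blast
  \<comment> \<open>Separability is reached through second countability, which every subspace of
    Cantor space inherits.\<close>
  moreover obtain h where h: "homeomorphic_map ?C refined_topology h"
    using hom homeomorphic_space by blast
  then have "separable_space refined_topology"
    using second_countable_imp_separable_space[OF second_countable_subtopology[OF second_countable_cantor]]
      separable_space_continuous_map_image homeomorphic_imp_continuous_map
      homeomorphic_imp_surjective_map by metis
  ultimately show ?thesis by (simp add: polish_topology_def)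
qed

end

subsection \<open>The enveloping space\<close>

lemma gdelta_in_continuous_map_preimage:
  assumes f: "continuous_map S T f" and "gdelta_in T A"
  shows "gdelta_in S {x \<in> topspace S. f x \<in> A}"
proof -
  obtain D :: "nat \<Rightarrow> 'b set" where D: "\<forall>n. openin T (D n)" "\<Inter>(range D) = A"
    using assms(2) unfolding gdelta_in_descending by blast
  have "gdelta_in S {x \<in> topspace S. \<forall>n. f x \<in> D n}"
    using D(1) f by (intro gdelta_in_Collect_all open_imp_gdelta_in)
      (auto intro: openin_continuous_map_preimage)
  moreover have "{x \<in> topspace S. \<forall>n. f x \<in> D n} = {x \<in> topspace S. f x \<in> A}"
    using D(2) by auto
  ultimately show ?thesis by simp
qed

text \<open>With countable bases, an open set is a countable union of open rectangles. This links
  continuity on a product space to the product sigma-algebra.\<close>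

lemma openin_prod_imp_measurable:
  fixes S :: "'a topology" and T :: "'b topology"
  assumes "second_countable S" "second_countable T" "openin (prod_topology S T) W"
  shows "W \<in> sets (borel_of S \<Otimes>\<^sub>M borel_of T)"
proof -
  obtain B :: "nat \<Rightarrow> 'a set" where B: "\<And>n. openin S (B n)"
    "\<And>U x. openin S U \<Longrightarrow> x \<in> U \<Longrightarrow> \<exists>n. x \<in> B n \<and> B n \<subseteq> U"
    using second_countable_nat_base[OF assms(1)] by blast
  obtain C :: "nat \<Rightarrow> 'b set" where C: "\<And>n. openin T (C n)"
    "\<And>U x. openin T U \<Longrightarrow> x \<in> U \<Longrightarrow> \<exists>n. x \<in> C n \<and> C n \<subseteq> U"
    using second_countable_nat_base[OF assms(2)] by blast
  have "W = (\<Union>(i, j)\<in>{(i, j). B i \<times> C j \<subseteq> W}. B i \<times> C j)"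
  proof (intro equalityI subsetI)
    fix p assume "p \<in> W"
    moreover obtain x y where p: "p = (x, y)" by force
    ultimately obtain U V where UV: "openin S U" "openin T V" "x \<in> U" "y \<in> V" "U \<times> V \<subseteq> W"
      using assms(3)[unfolded openin_prod_topology_alt, rule_format] by metis
    obtain i where i: "x \<in> B i" "B i \<subseteq> U" using B(2) UV by blast
    obtain j where j: "y \<in> C j" "C j \<subseteq> V" using C(2) UV by blast
    have "B i \<times> C j \<subseteq> W" using i(2) j(2) UV(5) by auto
    then show "p \<in> (\<Union>(i, j)\<in>{(i, j). B i \<times> C j \<subseteq> W}. B i \<times> C j)"
      using p i j by blast
  qed auto
  also have "\<dots> \<in> sets (borel_of S \<Otimes>\<^sub>M borel_of T)"
    by (intro sets.countable_UN'') (auto intro!: pair_measureI openin_imp_borel_of B(1) C(1))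
  finally show ?thesis .
qed

section \<open>Partial actions with open saturations and G-delta classes\<close>

locale polish_partial_action =
  topological_group G TG + partial_action G "topspace TX" m
  for G (structure) and TG :: "'g topology" and TX :: "'x topology" and m :: "'g \<times> 'x \<rightharpoonup> 'x" +
  assumes polish_TG: "polish_topology TG"
    and polish_TX: "polish_topology TX"
    and openin_dom: "g \<in> carrier G \<Longrightarrow> openin TX {x. (g, x) \<in> dom m}"
    and continuous: "continuous_map (subtopology (prod_topology TG TX) (dom m)) TX (\<lambda>p. the (m p))"
    and gdelta_dom: "gdelta_in (prod_topology TG TX) (dom m)"
begin

abbreviation P :: "('g \<times> 'x) topology" where
  "P \<equiv> prod_topology TG TX"

abbreviation q :: "'g \<times> 'x \<Rightarrow> ('g \<times> 'x) set" where
  "q \<equiv> env_class G (topspace TX) m"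

lemma topspace_P: "topspace P = carrier G \<times> topspace TX"
  by (simp add: topspace_eq)

lemma env_class_eq_iff:
  assumes "(g, x) \<in> topspace P" "(h, y) \<in> topspace P"
  shows "q (g, x) = q (h, y) \<longleftrightarrow> m (inv h \<otimes> g, x) = Some y"
proof -
  have "q (g, x) = q (h, y) \<longleftrightarrow> ((g, x), (h, y)) \<in> env_rel G (topspace TX) m"
    using assms unfolding env_class_def topspace_P
    by (intro eq_equiv_class_iff[OF equiv_env_rel])
  also have "\<dots> \<longleftrightarrow> m (inv h \<otimes> g, x) = Some y"
    using assms by (simp add: env_rel_iff topspace_eq)
  finally show ?thesis .
qed

lemma continuous_map_mult:
  assumes "continuous_map T TG f" "continuous_map T TG g"
  shows "continuous_map T TG (\<lambda>x. f x \<otimes> g x)"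
proof -
  have "continuous_map T (prod_topology TG TG) (\<lambda>x. (f x, g x))"
    using assms by (simp add: continuous_map_pairedI)
  from continuous_map_compose[OF this continuous_mult] show ?thesis
    by (simp add: comp_def)
qed

text \<open>For each \<open>k\<close>, the map \<open>f k\<close> sends \<open>(h, y)\<close> to the
  equivalent pair with entries \<open>h \<otimes> inv k\<close> and \<open>the (m (k, y))\<close>.
  It is continuous on the open set \<open>S k\<close>, and every pair \<open>(g, x)\<close>
  equivalent to \<open>(h, y)\<close> arises in this way from \<open>k = inv g \<otimes> h\<close>.
  The saturation of \<open>U\<close> is therefore the union of the open preimages of
  \<open>U\<close> under all \<open>f k\<close>.\<close>

lemma openin_env_saturation:
  assumes U: "openin P U"
  shows "openin P {p \<in> topspace P. q p \<in> q ` U}"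
proof -
  define S where "S k = carrier G \<times> {y. (k, y) \<in> dom m}" for k
  define f where "f k p = (fst p \<otimes> inv k, the (m (k, snd p)))" for k p
  have "openin P {p \<in> topspace (subtopology P (S k)). f k p \<in> U}" if k: "k \<in> carrier G" for k
  proof -
    have S: "openin P (S k)"
      using openin_dom[OF k] openin_topspace[of TG]
      by (simp add: S_def openin_prod_Times_iff topspace_eq)
    have fst: "continuous_map (subtopology P (S k)) TG fst"
      by (intro continuous_map_from_subtopology continuous_map_fst)
    have snd: "continuous_map (subtopology P (S k)) TX snd"
      by (intro continuous_map_from_subtopology continuous_map_snd)
    have "continuous_map (subtopology P (S k)) (subtopology P (dom m)) (\<lambda>p. (k, snd p))"
      unfolding continuous_map_in_subtopology
    proof
      show "continuous_map (subtopology P (S k)) P (\<lambda>p. (k, snd p))"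
        using k by (intro continuous_map_pairedI snd) (simp add: topspace_eq)
      show "(\<lambda>p. (k, snd p)) \<in> topspace (subtopology P (S k)) \<rightarrow> dom m"
        by (auto simp: S_def)
    qed
    from continuous_map_compose[OF this continuous]
    have "continuous_map (subtopology P (S k)) TX (\<lambda>p. the (m (k, snd p)))"
      by (simp add: comp_def)
    moreover have "continuous_map (subtopology P (S k)) TG (\<lambda>p. fst p \<otimes> inv k)"
      using k by (intro continuous_map_mult fst) (simp add: topspace_eq)
    ultimately have "continuous_map (subtopology P (S k)) P (f k)"
      unfolding f_def by (intro continuous_map_pairedI)
    then have "openin (subtopology P (S k)) {p \<in> topspace (subtopology P (S k)). f k p \<in> U}"
      using U by (rule openin_continuous_map_preimage)
    then show ?thesis
      using S openin_trans_full by blast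
  qed
  then have "openin P (\<Union>k\<in>carrier G. {p \<in> topspace (subtopology P (S k)). f k p \<in> U})"
    by (intro openin_Union) auto
  moreover have "{p \<in> topspace P. q p \<in> q ` U} =
      (\<Union>k\<in>carrier G. {p \<in> topspace (subtopology P (S k)). f k p \<in> U})"
  proof (intro equalityI subsetI)
    fix p assume p: "p \<in> {p \<in> topspace P. q p \<in> q ` U}"
    then obtain h y where hy: "p = (h, y)" "h \<in> carrier G" "y \<in> topspace TX"
      unfolding topspace_P by blast
    obtain g x where gx: "(g, x) \<in> U" "q (h, y) = q (g, x)"
      using p hy(1) by auto
    have gxP: "(g, x) \<in> topspace P" using gx(1) openin_subset[OF U] by blast
    then have g: "g \<in> carrier G" by (simp add: topspace_eq)
    have mx: "m (inv g \<otimes> h, y) = Some x"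
      using env_class_eq_iff[of h y g x] gx(2) gxP hy by (simp add: topspace_eq)
    have "h \<otimes> inv (inv g \<otimes> h) = g"
      using g hy(2) by (simp add: inv_mult_group flip: m_assoc)
    then have "f (inv g \<otimes> h) p \<in> U"
      using gx(1) mx hy(1) by (simp add: f_def)
    moreover have "p \<in> topspace (subtopology P (S (inv g \<otimes> h)))"
      using p hy mx by (auto simp: S_def)
    ultimately show "p \<in> (\<Union>k\<in>carrier G. {p \<in> topspace (subtopology P (S k)). f k p \<in> U})"
      using g hy(2) by (intro UN_I[of "inv g \<otimes> h"]) simp_all
  next
    fix p assume "p \<in> (\<Union>k\<in>carrier G. {p \<in> topspace (subtopology P (S k)). f k p \<in> U})"
    then obtain k where k: "k \<in> carrier G" "p \<in> topspace P" "p \<in> S k" "f k p \<in> U"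
      by auto
    obtain h y x where hy: "p = (h, y)" "m (k, y) = Some x"
      using k(3) by (auto simp: S_def)
    have h: "h \<in> carrier G" using k(2) hy(1) by (simp add: topspace_eq)
    have U': "(h \<otimes> inv k, x) \<in> U" using k(4) hy by (simp add: f_def)
    have "inv (h \<otimes> inv k) \<otimes> h = k"
      using h k(1) by (simp add: inv_mult_group m_assoc)
    then have "q (h, y) = q (h \<otimes> inv k, x)"
      using k(2) hy U' openin_subset[OF U] by (subst env_class_eq_iff) auto
    then show "p \<in> {p \<in> topspace P. q p \<in> q ` U}"
      using k(2) hy(1) U' by auto
  qed
  ultimately show ?thesis by simp
qed

text \<open>A pair \<open>p\<close> lies in the class of \<open>(h, x)\<close> exactly when
  \<open>m (f p) = Some x\<close>, where \<open>f\<close> translates the first entry by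
  \<open>inv h\<close>. The set \<open>S\<close> where \<open>m (f p)\<close> is defined is the
  preimage of a \<open>gdelta_in\<close> set, and within \<open>S\<close> the equation is a closed
  condition.\<close>

lemma gdelta_env_class:
  assumes "c \<in> q ` topspace P"
  shows "gdelta_in P {p \<in> topspace P. q p = c}"
proof -
  obtain h x where hx: "h \<in> carrier G" "x \<in> topspace TX" and c: "c = q (h, x)"
    using assms unfolding topspace_P by blast
  define f where "f = (\<lambda>p::'g \<times> 'x. (inv h \<otimes> fst p, snd p))"
  have f: "continuous_map P P f"
    unfolding f_def using hx
    by (intro continuous_map_pairedI continuous_map_mult continuous_map_fst continuous_map_snd)
      (simp add: topspace_eq)
  define S where "S = {p \<in> topspace P. f p \<in> dom m}"
  have S: "gdelta_in P S"
    unfolding S_def using f gdelta_dom by (rule gdelta_in_continuous_map_preimage)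
  have "continuous_map (subtopology P S) (subtopology P (dom m)) f"
    unfolding continuous_map_in_subtopology
    using continuous_map_from_subtopology[OF f] by (auto simp: S_def)
  from continuous_map_compose[OF this continuous]
  have "continuous_map (subtopology P S) TX (\<lambda>p. the (m (f p)))"
    by (simp add: comp_def)
  moreover have "metrizable_space TX"
    using polish_TX completely_metrizable_imp_metrizable_space by (auto simp: polish_topology_def)
  then have "closedin TX {x}"
    using hx(2) by (intro closedin_Hausdorff_singleton metrizable_imp_Hausdorff_space)
  ultimately have "closedin (subtopology P S) {p \<in> topspace (subtopology P S). the (m (f p)) \<in> {x}}"
    by (rule closedin_continuous_map_preimage)
  moreover have "metrizable_space P"
    using polish_prod_topology[OF polish_TG polish_TX] completely_metrizable_imp_metrizable_space
    by (auto simp: polish_topology_def)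
  ultimately have "gdelta_in (subtopology P S) {p \<in> topspace (subtopology P S). the (m (f p)) \<in> {x}}"
    by (intro closed_imp_gdelta_in metrizable_space_subtopology)
  then have "gdelta_in P {p \<in> topspace (subtopology P S). the (m (f p)) \<in> {x}}"
    using gdelta_in_gdelta_subtopology[OF S] by blast
  moreover have "{p \<in> topspace (subtopology P S). the (m (f p)) \<in> {x}} = {p \<in> topspace P. q p = c}"
  proof -
    have "p \<in> S \<and> the (m (f p)) = x \<longleftrightarrow> q p = c" if p: "p \<in> topspace P" for p
    proof -
      have "q p = c \<longleftrightarrow> m (f p) = Some x"
        using env_class_eq_iff[of "fst p" "snd p" h x] p hx c by (simp add: topspace_eq f_def)
      then show ?thesis using p by (auto simp: S_def)
    qed
    then show ?thesis by auto
  qed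
  ultimately show ?thesis by simp
qed

sublocale open_polish_quotient P q
  by unfold_locales
    (fact polish_prod_topology[OF polish_TG polish_TX] openin_env_saturation gdelta_env_class)+

section \<open>The embedding of the space and the enveloping action\<close>

lemma one_in_P: "x \<in> topspace TX \<Longrightarrow> (\<one>, x) \<in> topspace P"
  by (simp add: topspace_eq)

lemma continuous_map_env_embed: "continuous_map TX Y (env_embed G (topspace TX) m)"
proof -
  have "continuous_map TX P (\<lambda>x. (\<one>, x))"
    by (intro continuous_map_pairedI) (simp_all add: topspace_eq)
  from continuous_map_compose[OF this quotient_imp_continuous_map[OF quotient_map_quotient_topology[of P q]]]
  show ?thesis by (simp add: comp_def env_embed_def[abs_def])
qed

text \<open>Together with continuity this makes \<open>env_embed\<close> a topological embedding.
  Since \<open>m\<close> fixes \<open>x\<close> at \<open>\<one>\<close> and is continuous there,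
  some open \<open>W\<close> around \<open>(\<one>, x)\<close> has \<open>m\<close> sending
  \<open>W \<inter> dom m\<close> into \<open>V\<close>. If the class of \<open>(\<one>, y)\<close>
  contains some \<open>(g, z) \<in> W\<close>, then \<open>m (g, z) = Some y\<close>, so
  \<open>y \<in> V\<close>.\<close>

lemma openin_imp_env_embed_preimage:
  assumes V: "openin TX V"
  shows "\<exists>U. openin Y U \<and> V = env_embed G (topspace TX) m -` U \<inter> topspace TX"
proof -
  let ?\<iota> = "env_embed G (topspace TX) m"
  have "\<exists>U. openin Y U \<and> ?\<iota> x \<in> U \<and> ?\<iota> -` U \<inter> topspace TX \<subseteq> V" if x: "x \<in> V" for x
  proof -
    have xX: "x \<in> topspace TX" using x openin_subset[OF V] by blast
    have "openin (subtopology P (dom m)) {p \<in> topspace (subtopology P (dom m)). the (m p) \<in> V}"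
      using continuous V by (rule openin_continuous_map_preimage)
    then obtain W where W: "openin P W"
      "{p \<in> topspace (subtopology P (dom m)). the (m p) \<in> V} = W \<inter> dom m"
      unfolding openin_subtopology by blast
    have "(\<one>, x) \<in> {p \<in> topspace (subtopology P (dom m)). the (m p) \<in> V}"
      using x xX one_in_P[OF xX] PA3[OF xX] by auto
    then have "(\<one>, x) \<in> W" using W(2) by blast
    have "?\<iota> -` (q ` W) \<inter> topspace TX \<subseteq> V"
    proof
      fix y assume y: "y \<in> ?\<iota> -` (q ` W) \<inter> topspace TX"
      then obtain g z where gz: "(g, z) \<in> W" "q (\<one>, y) = q (g, z)"
        by (auto simp: env_embed_def)
      have gzP: "(g, z) \<in> topspace P" using gz(1) openin_subset[OF W(1)] by blast
      have "m (inv \<one> \<otimes> g, z) = Some y"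
        using env_class_eq_iff[OF gzP one_in_P, of y] gz(2) y by simp
      then have mz: "m (g, z) = Some y"
        using gzP by (simp add: topspace_eq)
      then have "(g, z) \<in> W \<inter> dom m" using gz(1) by auto
      then have "the (m (g, z)) \<in> V" unfolding W(2)[symmetric] by blast
      then show "y \<in> V" using mz by simp
    qed
    moreover have "?\<iota> x \<in> q ` W" using \<open>(\<one>, x) \<in> W\<close> by (auto simp: env_embed_def)
    ultimately show ?thesis using openin_image[OF W(1)] by blast
  qed
  then obtain U where U: "\<And>x. x \<in> V \<Longrightarrow> openin Y (U x) \<and> ?\<iota> x \<in> U x \<and> ?\<iota> -` U x \<inter> topspace TX \<subseteq> V"
    by metis
  have "openin Y (\<Union>x\<in>V. U x)" using U by blast
  moreover have "V = ?\<iota> -` (\<Union>x\<in>V. U x) \<inter> topspace TX"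
  proof (intro equalityI subsetI)
    fix x assume "x \<in> V"
    then show "x \<in> ?\<iota> -` (\<Union>x\<in>V. U x) \<inter> topspace TX"
      using U openin_subset[OF V] by blast
  next
    fix y assume "y \<in> ?\<iota> -` (\<Union>x\<in>V. U x) \<inter> topspace TX"
    then obtain x where "x \<in> V" "y \<in> ?\<iota> -` U x \<inter> topspace TX" by blast
    then show "y \<in> V" using U by blast
  qed
  ultimately show ?thesis by blast
qed

lemma continuous_map_env_act:
  "continuous_map (prod_topology TG Y) Y (env_act G (topspace TX) m)"
proof -
  let ?\<mu> = "env_act G (topspace TX) m"
  have act: "?\<mu> (g, q p) = q (g \<otimes> fst p, snd p)" if "g \<in> carrier G" "p \<in> topspace P" for g p
    using that env_act_class[of g "fst p" "snd p"] by (simp add: topspace_eq mem_Times_iff)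
  have cont: "continuous_map (prod_topology TG P) Y (\<lambda>r. q (fst r \<otimes> fst (snd r), snd (snd r)))"
  proof -
    have "continuous_map (prod_topology TG P) P (\<lambda>r. (fst r \<otimes> fst (snd r), snd (snd r)))"
      by (intro continuous_map_pairedI continuous_map_mult continuous_map_fst
          continuous_map_compose[OF continuous_map_snd continuous_map_fst, unfolded comp_def]
          continuous_map_compose[OF continuous_map_snd continuous_map_snd, unfolded comp_def])
    from continuous_map_compose[OF this quotient_imp_continuous_map[OF quotient_map_quotient_topology[of P q]]]
    show ?thesis by (simp add: comp_def)
  qed
  show ?thesis
    unfolding continuous_map_def
  proof (intro conjI allI impI)
    show "?\<mu> \<in> topspace (prod_topology TG Y) \<rightarrow> topspace Y"
    proof
      fix r assume "r \<in> topspace (prod_topology TG Y)"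
      then obtain g p where r: "r = (g, q p)" "g \<in> carrier G" "p \<in> topspace P"
        by (auto simp: topspace_eq)
      then show "?\<mu> r \<in> topspace Y"
        by (auto simp: act topspace_eq)
    qed
    fix U assume U: "openin Y U"
    let ?S = "{r \<in> topspace (prod_topology TG Y). ?\<mu> r \<in> U}"
    have pre: "openin (prod_topology TG P)
        {r \<in> topspace (prod_topology TG P). (\<lambda>r. q (fst r \<otimes> fst (snd r), snd (snd r))) r \<in> U}"
      using cont U by (rule openin_continuous_map_preimage)
    have "\<exists>A C. openin TG A \<and> openin Y C \<and> g \<in> A \<and> c \<in> C \<and> A \<times> C \<subseteq> ?S" if gc: "(g, c) \<in> ?S" for g c
    proof -
      obtain p where p: "c = q p" "p \<in> topspace P" and g: "g \<in> carrier G" and "?\<mu> (g, c) \<in> U"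
        using gc by (auto simp: topspace_eq)
      then have gp: "(g, p) \<in> {r \<in> topspace (prod_topology TG P). (\<lambda>r. q (fst r \<otimes> fst (snd r), snd (snd r))) r \<in> U}"
        using act[OF g p(2)] by (simp add: topspace_eq)
      obtain A W where AW: "openin TG A" "openin P W" "g \<in> A" "p \<in> W"
        "A \<times> W \<subseteq> {r \<in> topspace (prod_topology TG P). (\<lambda>r. q (fst r \<otimes> fst (snd r), snd (snd r))) r \<in> U}"
        using iffD1[OF openin_prod_topology_alt pre, rule_format, OF gp]
        by (elim exE conjE) (rule that)
      have "A \<times> q ` W \<subseteq> ?S"
      proof (clarify, intro conjI)
        fix g' p' assume gp: "g' \<in> A" "p' \<in> W"
        then have in': "(g', p') \<in> {r \<in> topspace (prod_topology TG P).
            (\<lambda>r. q (fst r \<otimes> fst (snd r), snd (snd r))) r \<in> U}"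
          using AW(5) by blast
        then have g': "g' \<in> carrier G" and p': "p' \<in> topspace P"
          by (auto simp: topspace_eq)
        show "(g', q p') \<in> topspace (prod_topology TG Y)"
          using g' p' by (auto simp: topspace_eq)
        show "?\<mu> (g', q p') \<in> U"
          using in' act[OF g' p'] by simp
      qed
      then show ?thesis
        using AW openin_image[OF AW(2)] p(1) by blast
    qed
    then show "openin (prod_topology TG Y) ?S"
      unfolding openin_prod_topology_alt by blast
  qed
qed

lemma second_countable_Y: "second_countable Y"
proof (rule second_countable_open_map_image)
  show "continuous_map P Y q"
    by (rule quotient_imp_continuous_map[OF quotient_map_quotient_topology])
  show "open_map P Y q" by (simp add: open_map_def openin_image)
  show "second_countable P" by (rule polish_imp_second_countable[OF polish])
qed simp

lemma env_act_measurable: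
  "env_act G (topspace TX) m \<in> measurable (borel_of TG \<Otimes>\<^sub>M borel_of Y) (borel_of Y)"
  unfolding borel_of_def[of Y, THEN arg_cong[where f = "\<lambda>N. measurable M N" for M]]
proof (rule measurable_measure_of)
  let ?\<mu> = "env_act G (topspace TX) m"
  show "{U. openin Y U} \<subseteq> Pow (topspace Y)" using openin_subset by blast
  have sp: "space (borel_of TG \<Otimes>\<^sub>M borel_of Y) = topspace (prod_topology TG Y)"
    by (simp add: space_pair_measure)
  show "?\<mu> \<in> space (borel_of TG \<Otimes>\<^sub>M borel_of Y) \<rightarrow> topspace Y"
    unfolding sp using continuous_map_env_act by (simp add: continuous_map_def)
  fix U assume "U \<in> {U. openin Y U}"
  then have "openin (prod_topology TG Y) {r \<in> topspace (prod_topology TG Y). ?\<mu> r \<in> U}"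
    using continuous_map_env_act openin_continuous_map_preimage by blast
  then have "{r \<in> topspace (prod_topology TG Y). ?\<mu> r \<in> U} \<in> sets (borel_of TG \<Otimes>\<^sub>M borel_of Y)"
    using polish_imp_second_countable[OF polish_TG] second_countable_Y
    by (intro openin_prod_imp_measurable)
  moreover have "?\<mu> -` U \<inter> space (borel_of TG \<Otimes>\<^sub>M borel_of Y) =
      {r \<in> topspace (prod_topology TG Y). ?\<mu> r \<in> U}"
    unfolding sp by auto
  ultimately show "?\<mu> -` U \<inter> space (borel_of TG \<Otimes>\<^sub>M borel_of Y) \<in> sets (borel_of TG \<Otimes>\<^sub>M borel_of Y)"
    by simp
qed

text \<open>Open sets of the space are traces of sets open in the quotient, hence of sets open in
  \<open>\<tau>\<close>. Conversely, a set open in \<open>\<tau>\<close> is Borel in the quotient,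
  and its preimage under the continuous embedding is Borel.\<close>

lemma sets_borel_env_embed:
  assumes \<tau>: "topspace \<tau> = topspace Y" "\<And>U. openin Y U \<Longrightarrow> openin \<tau> U"
    "sets (borel_of \<tau>) = sets (borel_of Y)"
  shows "sets (borel_of TX) =
    sets (borel_of (pullback_topology (topspace TX) (env_embed G (topspace TX) m) \<tau>))"
proof -
  let ?\<iota> = "env_embed G (topspace TX) m"
  let ?T = "pullback_topology (topspace TX) ?\<iota> \<tau>"
  have "?\<iota> x \<in> topspace Y" if "x \<in> topspace TX" for x
    using continuous_map_env_embed that unfolding continuous_map_def by blast
  then have top: "topspace ?T = topspace TX"
    unfolding topspace_pullback_topology \<tau>(1) by blast
  show ?thesis
  proof (rule antisym)
    show "sets (borel_of TX) \<subseteq> sets (borel_of ?T)"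
      unfolding sets_borel_of top
    proof (rule sigma_sets_mono', clarify)
      fix V assume "openin TX V"
      then show "openin ?T V"
        unfolding openin_pullback_topology using openin_imp_env_embed_preimage \<tau>(2) by blast
    qed
    have "S \<in> sets (borel_of TX)" if S': "openin ?T S" for S
    proof -
      obtain U where U: "openin \<tau> U" and S: "S = ?\<iota> -` U \<inter> topspace TX"
        using S' unfolding openin_pullback_topology by blast
      have "U \<in> sets (borel_of Y)"
        using openin_imp_borel_of[OF U] \<tau>(3) by simp
      from measurable_sets[OF continuous_map_measurable_borel_of[OF continuous_map_env_embed] this]
      show ?thesis using S by simp
    qed
    then show "sets (borel_of ?T) \<subseteq> sets (borel_of TX)"
      unfolding sets_borel_of[of ?T] top
      by (subst space_borel_of[symmetric], intro sets.sigma_sets_subset) auto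
  qed
qed

end

theorem theorem4p3:
  fixes G :: "('g, 'b) monoid_scheme"
    and TG :: "'g topology"
    and TX :: "'x topology"
    and m :: "'g \<times> 'x \<rightharpoonup> 'x"
  assumes "polish_group G TG"
    and "polish_topology TX"
    and "topological_partial_action G TX m"
    and "continuous_partial_action TG TX m"
    and "gdelta_in (prod_topology TG TX) (dom m)"
  shows "t0_space (env_topology G TG TX m) \<and>
    (\<exists>\<tau>. polish_topology \<tau> \<and>
         topspace \<tau> = env_space G (topspace TX) m \<and>
         (\<forall>U. openin (env_topology G TG TX m) U \<longrightarrow> openin \<tau> U) \<and>
         env_borel_sets G TG TX m = sets (borel_of \<tau>) \<and>
         sets (borel_of TX) =
           sets (borel_of (pullback_topology (topspace TX) (env_embed G (topspace TX) m) \<tau>)) \<and>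
         env_act G (topspace TX) m
           \<in> measurable (borel_of TG \<Otimes>\<^sub>M borel_of \<tau>) (borel_of \<tau>))"
proof -
  interpret G: topological_group G TG
    using assms(1) by (simp add: polish_group_def)
  interpret pa: partial_action G "topspace TX" m
    using assms(3) by (simp add: topological_partial_action_def)
  interpret polish_partial_action G TG TX m
  proof unfold_locales
    show "openin TX {x. (g, x) \<in> dom m}" if g: "g \<in> carrier G" for g
    proof -
      have "openin TX (pa_dom G m (inv\<^bsub>G\<^esub> g))"
        using assms(3) g by (simp add: topological_partial_action_def)
      then show ?thesis using g by (simp add: pa_dom_def)
    qed
  qed (use assms in \<open>simp_all add: polish_group_def continuous_partial_action_def\<close>)
  obtain B :: "nat \<Rightarrow> ('g \<times> 'x) set" where B: "\<And>n. openin P (B n)"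
    "\<And>U x. openin P U \<Longrightarrow> x \<in> U \<Longrightarrow> \<exists>n. x \<in> B n \<and> B n \<subseteq> U"
    using second_countable_nat_base[OF polish_imp_second_countable[OF polish]] by blast
  interpret based_open_polish_quotient P q B
    by unfold_locales (use B in auto)
  have Y: "env_topology G TG TX m = Y" by (simp add: env_topology_def)
  have "topspace Y = env_space G (topspace TX) m"
    using topspace_env_topology[OF G.topspace_eq, of TX m] unfolding Y .
  moreover have "env_borel_sets G TG TX m = sets (borel_of refined_topology)"
    by (simp add: env_borel_sets_def quotient_borel_sets_eq sets_borel_refined)
  \<comment> \<open>Measurability depends only on the sigma-algebras, and the refined topology has
    the Borel sets of the quotient topology.\<close>
  moreover have "env_act G (topspace TX) m
      \<in> measurable (borel_of TG \<Otimes>\<^sub>M borel_of refined_topology) (borel_of refined_topology)"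
    using env_act_measurable
      measurable_cong_sets[OF sets_pair_measure_cong[OF refl sets_borel_refined] sets_borel_refined]
    by blast
  ultimately show ?thesis
    unfolding Y using t0_quotient polish_refined topspace_refined openin_refined
      sets_borel_env_embed[OF topspace_refined openin_refined sets_borel_refined]
    by (intro conjI exI[of _ refined_topology]) simp_all
qed

end
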